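(* Every simple object in the category $\mathcal O$ of $\mathcal U_q(\mathfrak b^\sigma)$-modules is an $l$-highest weight module.
   Context: Twisted data. $\mathfrak g$ is a simple complex Lie algebra of type $A_m$ ($m\ge2$), $D_m$ ($m\ge4$) or $E_6$ with Dynkin nodes $I$ and Cartan matrix $C$; $\sigma:I\to I$ is a non-trivial diagram automorphism of order $M\in\{2,3\}$; $\omega=e^{2\pi\sqrt{-1}/M}$. $I_\sigma$ is the set of $\sigma$-orbits, $\bar i$ the orbit of $i$; in each orbit a representative is fixed, the smallest node in the standard labelling ($1,\dots,n$ for $A_{2n}^{(2)},A_{2n-1}^{(2)},D_{n+1}^{(2)}$; $1$ and the trivalent node $2$ for $D_4^{(3)}$; in all cases a connected subdiagram). $d_{\bar i}=\frac12\sum_{r=1}^MC_{i,\sigma^r(i)}$. $\hat I_\sigma=I_\sigma\sqcup\{\epsilon\}$; $C^\sigma$ is the generalized Cartan matrix of the twisted affine type, $\epsilon$ the affine node (for $A_{2n}^{(2)}$ the end node with longest root), so $d_{\bar i}C^\sigma_{\bar i,\bar j}=\sum_{r=1}^MC_{i,\sigma^r(j)}$ on $I_\sigma$; $d_\epsilon$ makes $(d_iC^\sigma_{i,j})$ symmetric; $(a_i)_{i\in\hat I_\sigma}$ are the positive integers with $\sum_ia_id_iC^\sigma_{i,j}=0$ for all $j$, $a_\epsilon=1$. $q\in\mathbb C^*$ is not a root of unity (with a fixed square root), $q_i=q^{d_i}$, $[m]_p=\frac{p^m-p^{-m}}{p-p^{-1}}$. Algebra. $\mathcal U_q(\mathcal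 L\mathfrak g^\sigma)$ has generators $e_i^\pm,k_i^{\pm1}$ ($i\in\hat I_\sigma$) and relations: the $k_i$ are invertible and commute, $k_ie_j^\pm=q_i^{\pm C^\sigma_{i,j}}e_j^\pm k_i$, $[e_i^+,e_j^-]=\delta_{i,j}\frac{k_i-k_i^{-1}}{q_i-q_i^{-1}}$, the quantum Serre relations of $C^\sigma$, and $\prod_ik_i^{a_i}=1$. It is also generated by the Drinfeld generators $x_{i,m}^\pm$ ($m\in\mathbb Z$), $h_{i,r}$ ($r\neq0$), $k_i^{\pm1}$, $i\in I$, of its Drinfeld presentation (Chari–Pressley, Damiani), where $x_{i,0}^\pm=e_{\bar i}^\pm$, $k_i=k_{\bar i}$ for representatives $i$, $e_\epsilon^\pm$ has degree $\pm1$ for the grading $\deg x_{i,m}^\pm=m,\deg h_{i,r}=r,\deg k_i=0$, and $x_{\sigma(i),m}^\pm=\omega^mx_{i,m}^\pm$, $h_{\sigma(i),r}=\omega^rh_{i,r}$, $k_{\sigma(i)}=k_i$, the $h$'s and $k$'s commute, $k_ix_{j,m}^\pm=q^{\pm\sum_{r=1}^MC_{i,\sigma^r(j)}}x_{j,m}^\pm k_i$, $[h_{i,s},x_{j,l}^\pm]=\pm\frac1s\left(\sum_{r=1}^M[sC_{i,\sigma^r(j)}/d_{\bar i}]_{q_{\bar i}}\omega^{sr}\right)x_{j,s+l}^\pm$, $[x_{i,s}^+,x_{j,l}^-]=\frac{\sum_{r=1}^M\delta_{\sigma^r(i),j}\omega^{rl}}{N_i}\frac{\phi_{i,s+l}^+-\phi_{i,s+l}^-}{q_{\bar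 i}-q_{\bar i}^{-1}}$ with $N_i=M$ if $\sigma(i)=i$, $N_i=1$ otherwise, and $\phi_i^\pm(u)=\sum_{m\ge0}\phi^\pm_{i,\pm m}u^{\pm m}=k_i^{\pm1}\exp(\pm(q_{\bar i}-q_{\bar i}^{-1})\sum_{l\ge1}h_{i,\pm l}u^{\pm l})$ (other $\phi^\pm_{i,m}$ are $0$). Borel subalgebra and category $\mathcal O$. $\mathcal U_q(\mathfrak b^\sigma)$ is the subalgebra generated by $e_i^+,k_i^{\pm1}$ ($i\in\hat I_\sigma$); it contains $x^+_{i,r}$, $\phi^+_{i,r}$ ($r\ge0$). A $\mathcal U_q(\mathfrak b^\sigma)$-module is an $l$-highest weight module if it is generated by a vector $v$ such that, for some $(\gamma_i(u))_{i\in I}\in\mathbb C[[u]]^I$, $x^+_{i,r}v=0$ and $\phi_i^+(u)v=\gamma_i(u)v$ for all $i\in I$, $r\ge0$. $\mathfrak t$ is the subalgebra generated by the $k_{\bar i}^{\pm1}$, $\bar i\in I_\sigma$; $\mathfrak t^*$ is the group of its algebra characters, written additively; $\alpha_{\bar i}(k_{\bar j})=q_{\bar i}^{C^\sigma_{\bar i,\bar j}}$; $\lambda\le\mu$ iff $\mu-\lambda\in\sum\mathbb N\alpha_{\bar i}$; $D(\lambda)=\{\mu\le\lambda\}$. $\mathcal O$ is the category of $\mathcal U_q(\mathfrak b^\sigma)$-modules that are $\mathfrak t$-diagonalizable with finite-dimensional weight spaces and weights in a finite union of sets $D(\lambda_s)$. *)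

theory Defs
  imports
    Complex_Main
    "HOL-Library.Poly_Mapping"
    "HOL-Combinatorics.Permutations"
    "HOL-Computational_Algebra.Formal_Power_Series"
    "HOL-Algebra.QuotRing"
    "HOL-Algebra.Generated_Rings"
begin

section \<open>Twisted Cartan data\<close>

datatype dynkin = TypeA nat | TypeD nat | TypeE6

fun admissible :: "dynkin \<Rightarrow> bool" where
  "admissible (TypeA m) \<longleftrightarrow> m \<ge> 2"
| "admissible (TypeD m) \<longleftrightarrow> m \<ge> 4"
| "admissible TypeE6 \<longleftrightarrow> True"

fun nodes :: "dynkin \<Rightarrow> nat set" where
  "nodes (TypeA m) = {1..m}"
| "nodes (TypeD m) = {1..m}"
| "nodes TypeE6 = {1..6}"

text \<open>Bourbaki labelling; every edge is listed once, with \<open>i < j\<close>.\<close>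

fun edge :: "dynkin \<Rightarrow> nat \<Rightarrow> nat \<Rightarrow> bool" where
  "edge (TypeA m) i j \<longleftrightarrow> j = i + 1"
| "edge (TypeD m) i j \<longleftrightarrow> j = i + 1 \<and> j < m \<or> i + 2 = m \<and> j = m"
| "edge TypeE6 i j \<longleftrightarrow> (i, j) \<in> {(1, 3), (3, 4), (4, 5), (5, 6), (2, 4)}"

definition cartan :: "dynkin \<Rightarrow> nat \<Rightarrow> nat \<Rightarrow> int" where
  "cartan X i j = (if i = j then 2 else if edge X i j \<or> edge X j i then - 1 else 0)"

text \<open>
  \<open>qhalf\<close> is the fixed square root of \<open>q\<close>; it is needed because \<open>d\<^sub>i\<close> may be \<open>1/2\<close>.
\<close>

record twisted =
  dyn :: dynkin
  sigma :: "nat \<Rightarrow> nat"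
  aut_order :: nat
  qhalf :: complex

definition qpar :: "twisted \<Rightarrow> complex" where
  "qpar T = qhalf T ^ 2"

definition omega :: "twisted \<Rightarrow> complex" where
  "omega T = exp (2 * complex_of_real pi * \<i> / of_nat (aut_order T))"

text \<open>As \<open>M\<close> is prime, the conditions on \<open>\<sigma>\<close> say that it has order exactly \<open>M\<close>.\<close>

locale twisted_data =
  fixes T :: twisted
  assumes dyn_admissible: "admissible (dyn T)"
    and sigma_permutes: "sigma T permutes nodes (dyn T)"
    and sigma_cartan: "\<And>i j. i \<in> nodes (dyn T) \<Longrightarrow> j \<in> nodes (dyn T) \<Longrightarrow>
          cartan (dyn T) (sigma T i) (sigma T j) = cartan (dyn T) i j"
    and order_cases: "aut_order T \<in> {2, 3}"
    and sigma_order: "\<And>i. (sigma T ^^ aut_order T) i = i"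
    and sigma_nontrivial: "\<exists>i. sigma T i \<noteq> i"
    and q_nonzero: "qpar T \<noteq> 0"
    and q_not_root_of_unity: "\<And>n::nat. n > 0 \<Longrightarrow> qpar T ^ n \<noteq> 1"

text \<open>
  An orbit is represented by its smallest node, so that \<open>I\<^sub>\<sigma>\<close> becomes a set of nodes and
  \<open>orb T i\<close> stands for the orbit of \<open>i\<close>. The set of indices of the affine diagram is then a
  subset of \<open>nat option\<close>, where \<open>None\<close> is the affine node \<open>\<epsilon>\<close>.
\<close>

definition orb :: "twisted \<Rightarrow> nat \<Rightarrow> nat" where
  "orb T i = Min ((\<lambda>r. (sigma T ^^ r) i) ` {..<aut_order T})"

definition reps :: "twisted \<Rightarrow> nat set" where
  "reps T = orb T ` nodes (dyn T)"

definition affine_nodes :: "twisted \<Rightarrow> nat option set" where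
  "affine_nodes T = insert None (Some ` reps T)"

definition csum :: "twisted \<Rightarrow> nat \<Rightarrow> nat \<Rightarrow> int" where
  "csum T i j = (\<Sum>r = 1..aut_order T. cartan (dyn T) i ((sigma T ^^ r) j))"

text \<open>
  The labels \<open>a\<^sub>i\<close>, for \<open>i\<close> the representative of its orbit:
  \<open>A\<^sub>2\<^sub>n\<^sup>(\<^sup>2\<^sup>)\<close>: \<open>2,\<dots>,2\<close> (the affine node is the long end node);
  \<open>A\<^sub>2\<^sub>n\<^sub>-\<^sub>1\<^sup>(\<^sup>2\<^sup>)\<close>: \<open>1,2,\<dots>,2,1\<close> (and \<open>1,1\<close> for \<open>n = 2\<close>);
  \<open>D\<^sub>n\<^sub>+\<^sub>1\<^sup>(\<^sup>2\<^sup>)\<close>: \<open>1,\<dots>,1\<close>;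
  \<open>D\<^sub>4\<^sup>(\<^sup>3\<^sup>)\<close>: \<open>1\<close> at the trivalent node and \<open>2\<close> at the other one;
  \<open>E\<^sub>6\<^sup>(\<^sup>2\<^sup>)\<close>: \<open>2,3,2,1\<close> along the chain \<open>1,3,4,2\<close>.
\<close>

fun label :: "twisted \<Rightarrow> nat option \<Rightarrow> nat" where
  "label T None = 1"
| "label T (Some i) = (case dyn T of
      TypeA m \<Rightarrow> (if even m then 2 else if i = 1 \<or> 2 * i = m + 1 then 1 else 2)
    | TypeD m \<Rightarrow> (if aut_order T = 2 \<or> i = 2 then 1 else 2)
    | TypeE6 \<Rightarrow> (if i = 2 then 1 else if i = 3 then 3 else 2))"

text \<open>
  The symmetric matrix \<open>d\<^sub>i C\<^sup>\<sigma>\<^sub>i\<^sub>j\<close>. On \<open>I\<^sub>\<sigma>\<close> it is \<open>csum\<close>; the row and the column of \<open>\<epsilon>\<close> are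
  forced by \<open>\<Sum>\<^sub>i a\<^sub>i d\<^sub>i C\<^sup>\<sigma>\<^sub>i\<^sub>j = 0\<close> and \<open>a\<^sub>\<epsilon> = 1\<close>. Its diagonal is \<open>2 d\<^sub>i\<close>, so \<open>d\<^sub>i\<close> and \<open>C\<^sup>\<sigma>\<close> are
  recovered from it; the division in \<open>csig\<close> is exact.
\<close>

fun aff_form :: "twisted \<Rightarrow> nat option \<Rightarrow> nat option \<Rightarrow> int" where
  "aff_form T (Some i) (Some j) = csum T i j"
| "aff_form T None (Some j) = - (\<Sum>i\<in>reps T. int (label T (Some i)) * csum T i j)"
| "aff_form T (Some i) None = - (\<Sum>j\<in>reps T. int (label T (Some j)) * csum T i j)"
| "aff_form T None None =
     (\<Sum>i\<in>reps T. \<Sum>j\<in>reps T. int (label T (Some i)) * int (label T (Some j)) * csum T i j)"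

definition csig :: "twisted \<Rightarrow> nat option \<Rightarrow> nat option \<Rightarrow> int" where
  "csig T i j = 2 * aff_form T i j div aff_form T i i"

text \<open>\<open>q\<^sub>i = q\<close> to the power \<open>d\<^sub>i\<close>, i.e. \<open>qhalf\<close> to the power \<open>2 d\<^sub>i\<close>.\<close>

definition qi :: "twisted \<Rightarrow> nat option \<Rightarrow> complex" where
  "qi T i = qhalf T powi aff_form T i i"

definition qint :: "complex \<Rightarrow> int \<Rightarrow> complex" where
  "qint p m = (p powi m - p powi (- m)) / (p - inverse p)"

definition qfact :: "complex \<Rightarrow> nat \<Rightarrow> complex" where
  "qfact p n = (\<Prod>k = 1..n. qint p (int k))"

definition qbinom :: "complex \<Rightarrow> nat \<Rightarrow> nat \<Rightarrow> complex" where
  "qbinom p n r = qfact p n / (qfact p r * qfact p (n - r))"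


section \<open>The twisted quantum loop algebra\<close>

datatype pm = Plus | Minus

fun sgn_of :: "pm \<Rightarrow> int" where
  "sgn_of Plus = 1"
| "sgn_of Minus = - 1"

datatype gen = E pm "nat option" | K "nat option" | Kinv "nat option"

text \<open>
  With concatenation as addition on words, \<open>gen list \<Rightarrow>\<^sub>0 complex\<close> with its convolution product
  is the free associative algebra on the type \<open>gen\<close>.
\<close>

instantiation list :: (type) monoid_add
begin
definition zero_list :: "'a list" where "zero_list = []"
definition plus_list :: "'a list \<Rightarrow> 'a list \<Rightarrow> 'a list" where "plus_list = (@)"
instance by standard (simp_all add: zero_list_def plus_list_def)
end

type_synonym falg = "gen list \<Rightarrow>\<^sub>0 complex"

definition gens :: "twisted \<Rightarrow> gen set" where
  "gens T = (\<Union>i\<in>affine_nodes T. {E Plus i, E Minus i, K i, Kinv i})"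

definition free_alg :: "twisted \<Rightarrow> falg ring" where
  "free_alg T = \<lparr>carrier = {p. \<forall>w\<in>Poly_Mapping.keys p. set w \<subseteq> gens T},
     mult = (*), one = 1, zero = 0, add = (+)\<rparr>"

definition fgen :: "gen \<Rightarrow> falg" where
  "fgen g = Poly_Mapping.single [g] 1"

definition fscal :: "complex \<Rightarrow> falg" where
  "fscal c = Poly_Mapping.single [] c"

definition serre :: "twisted \<Rightarrow> pm \<Rightarrow> nat option \<Rightarrow> nat option \<Rightarrow> falg" where
  "serre T s i j = (let n = nat (1 - csig T i j) in
     \<Sum>r\<le>n. fscal ((- 1) ^ r * qbinom (qi T i) n r)
             * fgen (E s i) ^ (n - r) * fgen (E s j) * fgen (E s i) ^ r)"

definition relations :: "twisted \<Rightarrow> falg set" where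
  "relations T =
     {fgen (K i) * fgen (Kinv i) - 1 | i. i \<in> affine_nodes T}
   \<union> {fgen (Kinv i) * fgen (K i) - 1 | i. i \<in> affine_nodes T}
   \<union> {fgen (K i) * fgen (K j) - fgen (K j) * fgen (K i) | i j.
        i \<in> affine_nodes T \<and> j \<in> affine_nodes T}
   \<union> {fgen (K i) * fgen (E s j)
        - fscal (qi T i powi (sgn_of s * csig T i j)) * fgen (E s j) * fgen (K i) | s i j.
        i \<in> affine_nodes T \<and> j \<in> affine_nodes T}
   \<union> {fgen (E Plus i) * fgen (E Minus j) - fgen (E Minus j) * fgen (E Plus i)
        - (if i = j then fscal (1 / (qi T i - inverse (qi T i))) * (fgen (K i) - fgen (Kinv i))
           else 0) | i j.
        i \<in> affine_nodes T \<and> j \<in> affine_nodes T}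
   \<union> {serre T s i j | s i j. i \<in> affine_nodes T \<and> j \<in> affine_nodes T \<and> i \<noteq> j}
   \<union> {fgen (K None)
        * prod_list (map (\<lambda>i. fgen (K (Some i)) ^ label T (Some i)) (sorted_list_of_set (reps T)))
        - 1}"

definition rel_ideal :: "twisted \<Rightarrow> falg set" where
  "rel_ideal T = genideal (free_alg T) (relations T)"

definition UL :: "twisted \<Rightarrow> falg set ring" where
  "UL T = free_alg T Quot rel_ideal T"

definition cls :: "twisted \<Rightarrow> falg \<Rightarrow> falg set" where
  "cls T p = rel_ideal T +>\<^bsub>free_alg T\<^esub> p"

definition eU :: "twisted \<Rightarrow> pm \<Rightarrow> nat option \<Rightarrow> falg set" where
  "eU T s i = cls T (fgen (E s i))"

definition kU :: "twisted \<Rightarrow> nat option \<Rightarrow> falg set" where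
  "kU T i = cls T (fgen (K i))"

definition kinvU :: "twisted \<Rightarrow> nat option \<Rightarrow> falg set" where
  "kinvU T i = cls T (fgen (Kinv i))"

definition scU :: "twisted \<Rightarrow> complex \<Rightarrow> falg set" where
  "scU T c = cls T (fscal c)"

definition smulU :: "twisted \<Rightarrow> complex \<Rightarrow> falg set \<Rightarrow> falg set" where
  "smulU T c a = scU T c \<otimes>\<^bsub>UL T\<^esub> a"

definition commU :: "twisted \<Rightarrow> falg set \<Rightarrow> falg set \<Rightarrow> falg set" where
  "commU T a b = a \<otimes>\<^bsub>UL T\<^esub> b \<ominus>\<^bsub>UL T\<^esub> b \<otimes>\<^bsub>UL T\<^esub> a"

definition subalg_gen :: "twisted \<Rightarrow> falg set set \<Rightarrow> falg set set" where
  "subalg_gen T S = generate_ring (UL T) (range (scU T) \<union> S)"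

definition borel :: "twisted \<Rightarrow> falg set set" where
  "borel T = subalg_gen T (\<Union>i\<in>affine_nodes T. {eU T Plus i, kU T i, kinvU T i})"

definition torus :: "twisted \<Rightarrow> falg set set" where
  "torus T = subalg_gen T (\<Union>i\<in>reps T. {kU T (Some i), kinvU T (Some i)})"


section \<open>Drinfeld generators\<close>

text \<open>
  A sequence \<open>f\<close> in \<open>U\<close> is read as the power series \<open>\<Sum> f l u\<^sup>l\<close>; \<open>psU_power T f n m\<close> is the
  coefficient of \<open>u\<^sup>m\<close> in its \<open>n\<close>-th power. In \<open>psU_exp\<close> the truncation at \<open>n \<le> m\<close> loses
  nothing, as it is only used for series without constant term.
\<close>

primrec psU_power :: "twisted \<Rightarrow> (nat \<Rightarrow> falg set) \<Rightarrow> nat \<Rightarrow> nat \<Rightarrow> falg set" where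
  "psU_power T f 0 = (\<lambda>m. if m = 0 then \<one>\<^bsub>UL T\<^esub> else \<zero>\<^bsub>UL T\<^esub>)"
| "psU_power T f (Suc n) = (\<lambda>m. finsum (UL T) (\<lambda>l. f l \<otimes>\<^bsub>UL T\<^esub> psU_power T f n (m - l)) {..m})"

definition psU_exp :: "twisted \<Rightarrow> (nat \<Rightarrow> falg set) \<Rightarrow> nat \<Rightarrow> falg set" where
  "psU_exp T f m = finsum (UL T) (\<lambda>n. smulU T (1 / fact n) (psU_power T f n m)) {..m}"

definition kpm :: "twisted \<Rightarrow> pm \<Rightarrow> nat \<Rightarrow> falg set" where
  "kpm T s i = (case s of Plus \<Rightarrow> kU T (Some (orb T i)) | Minus \<Rightarrow> kinvU T (Some (orb T i)))"

definition qdiff :: "twisted \<Rightarrow> nat \<Rightarrow> complex" where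
  "qdiff T i = qi T (Some (orb T i)) - inverse (qi T (Some (orb T i)))"

definition phiU :: "twisted \<Rightarrow> (nat \<Rightarrow> int \<Rightarrow> falg set) \<Rightarrow> pm \<Rightarrow> nat \<Rightarrow> int \<Rightarrow> falg set" where
  "phiU T h s i m = (if sgn_of s * m < 0 then \<zero>\<^bsub>UL T\<^esub> else
     kpm T s i \<otimes>\<^bsub>UL T\<^esub>
       psU_exp T (\<lambda>l. if l = 0 then \<zero>\<^bsub>UL T\<^esub>
                       else smulU T (of_int (sgn_of s) * qdiff T i) (h i (sgn_of s * int l)))
         (nat \<bar>m\<bar>))"

text \<open>
  The bracket \<open>[s C\<^sub>i\<^sub>,\<^sub>\<sigma>\<^sup>r\<^sub>(\<^sub>j\<^sub>) / d\<^sub>i]\<close> at \<open>q\<^sub>i\<close> may have a fractional argument, but as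
  \<open>q\<^sub>i = q\<close> to the power \<open>d\<^sub>i\<close>, its numerator only involves \<open>q\<close> to the power \<open>\<plusminus> s C\<^sub>i\<^sub>,\<^sub>\<sigma>\<^sup>r\<^sub>(\<^sub>j\<^sub>)\<close>.
\<close>

definition hx_coeff :: "twisted \<Rightarrow> nat \<Rightarrow> nat \<Rightarrow> int \<Rightarrow> complex" where
  "hx_coeff T i j s = (1 / of_int s) *
     (\<Sum>r = 1..aut_order T.
        (qpar T powi (s * cartan (dyn T) i ((sigma T ^^ r) j))
         - qpar T powi (- (s * cartan (dyn T) i ((sigma T ^^ r) j)))) / qdiff T i
        * omega T powi (s * int r))"

definition xx_coeff :: "twisted \<Rightarrow> nat \<Rightarrow> nat \<Rightarrow> int \<Rightarrow> complex" where
  "xx_coeff T i j l =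
     (\<Sum>r = 1..aut_order T. (if (sigma T ^^ r) i = j then omega T powi (int r * l) else 0))
     / (if sigma T i = i then of_nat (aut_order T) else 1)"

definition Z_grading :: "twisted \<Rightarrow> (int \<Rightarrow> falg set set) \<Rightarrow> bool" where
  "Z_grading T G \<longleftrightarrow>
     (\<forall>n. additive_subgroup (G n) (UL T)) \<and>
     range (scU T) \<subseteq> G 0 \<and>
     (\<forall>m n. \<forall>a\<in>G m. \<forall>b\<in>G n. a \<otimes>\<^bsub>UL T\<^esub> b \<in> G (m + n)) \<and>
     (\<forall>a\<in>carrier (UL T). \<exists>S f. finite S \<and> (\<forall>n\<in>S. f n \<in> G n) \<and> a = finsum (UL T) f S) \<and>
     (\<forall>S f. finite S \<and> (\<forall>n\<in>S. f n \<in> G n) \<and> finsum (UL T) f S = \<zero>\<^bsub>UL T\<^esub>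
        \<longrightarrow> (\<forall>n\<in>S. f n = \<zero>\<^bsub>UL T\<^esub>))"

text \<open>
  The Drinfeld generators of \<open>U\<close>, given by the properties that they have by the theorems of
  Chari--Pressley and Damiani. The existence of such a family is not proved here. The quadratic
  and Serre-type relations among the \<open>x\<^sub>i\<^sub>,\<^sub>m\<^sup>\<plusminus>\<close> are not required, so this covers at least the
  actual Drinfeld generators. The last two assumptions are the standard fact that the Borel
  subalgebra contains the \<open>x\<^sub>i\<^sub>,\<^sub>r\<^sup>+\<close> and \<open>\<phi>\<^sub>i\<^sub>,\<^sub>r\<^sup>+\<close> with \<open>r \<ge> 0\<close>; without it their action on a module over
  that subalgebra has no meaning. The values \<open>h i 0\<close> are irrelevant.
\<close>

locale drinfeld_generators =
  fixes T :: twisted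
    and x :: "pm \<Rightarrow> nat \<Rightarrow> int \<Rightarrow> falg set"
    and h :: "nat \<Rightarrow> int \<Rightarrow> falg set"
  assumes x_carrier: "\<And>s i m. i \<in> nodes (dyn T) \<Longrightarrow> x s i m \<in> carrier (UL T)"
    and h_carrier: "\<And>i r. i \<in> nodes (dyn T) \<Longrightarrow> r \<noteq> 0 \<Longrightarrow> h i r \<in> carrier (UL T)"
    and generate:
      "subalg_gen T ({x s i m | s i m. i \<in> nodes (dyn T)}
         \<union> {h i r | i r. i \<in> nodes (dyn T) \<and> r \<noteq> 0}
         \<union> {kpm T s i | s i. i \<in> nodes (dyn T)}) = carrier (UL T)"
    and x_zero: "\<And>s i. i \<in> reps T \<Longrightarrow> x s i 0 = eU T s (Some i)"
    and grading:
      "\<exists>G. Z_grading T G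
         \<and> (\<forall>s. \<forall>i\<in>nodes (dyn T). \<forall>m. x s i m \<in> G m)
         \<and> (\<forall>i\<in>nodes (dyn T). \<forall>r. r \<noteq> 0 \<longrightarrow> h i r \<in> G r)
         \<and> (\<forall>s. \<forall>i\<in>nodes (dyn T). kpm T s i \<in> G 0)
         \<and> (\<forall>s. eU T s None \<in> G (sgn_of s))"
    and x_sigma: "\<And>s i m. i \<in> nodes (dyn T) \<Longrightarrow>
      x s (sigma T i) m = smulU T (omega T powi m) (x s i m)"
    and h_sigma: "\<And>i r. i \<in> nodes (dyn T) \<Longrightarrow> r \<noteq> 0 \<Longrightarrow>
      h (sigma T i) r = smulU T (omega T powi r) (h i r)"
    and h_h: "\<And>i j r s. i \<in> nodes (dyn T) \<Longrightarrow> j \<in> nodes (dyn T) \<Longrightarrow> r \<noteq> 0 \<Longrightarrow> s \<noteq> 0 \<Longrightarrow>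
      h i r \<otimes>\<^bsub>UL T\<^esub> h j s = h j s \<otimes>\<^bsub>UL T\<^esub> h i r"
    and k_h: "\<And>s i j r. i \<in> nodes (dyn T) \<Longrightarrow> j \<in> nodes (dyn T) \<Longrightarrow> r \<noteq> 0 \<Longrightarrow>
      kpm T s i \<otimes>\<^bsub>UL T\<^esub> h j r = h j r \<otimes>\<^bsub>UL T\<^esub> kpm T s i"
    and k_x: "\<And>s i j m. i \<in> nodes (dyn T) \<Longrightarrow> j \<in> nodes (dyn T) \<Longrightarrow>
      kpm T Plus i \<otimes>\<^bsub>UL T\<^esub> x s j m
        = smulU T (qpar T powi (sgn_of s * csum T i j)) (x s j m \<otimes>\<^bsub>UL T\<^esub> kpm T Plus i)"
    and h_x: "\<And>s i j r l. i \<in> nodes (dyn T) \<Longrightarrow> j \<in> nodes (dyn T) \<Longrightarrow> r \<noteq> 0 \<Longrightarrow>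
      commU T (h i r) (x s j l)
        = smulU T (of_int (sgn_of s) * hx_coeff T i j r) (x s j (r + l))"
    and x_x: "\<And>i j r l. i \<in> nodes (dyn T) \<Longrightarrow> j \<in> nodes (dyn T) \<Longrightarrow>
      commU T (x Plus i r) (x Minus j l)
        = smulU T (xx_coeff T i j l / qdiff T i)
            (phiU T h Plus i (r + l) \<ominus>\<^bsub>UL T\<^esub> phiU T h Minus i (r + l))"
    and x_borel: "\<And>i r. i \<in> nodes (dyn T) \<Longrightarrow> r \<ge> 0 \<Longrightarrow> x Plus i r \<in> borel T"
    and phi_borel: "\<And>i r. i \<in> nodes (dyn T) \<Longrightarrow> r \<ge> 0 \<Longrightarrow> phiU T h Plus i r \<in> borel T"


section \<open>Modules over the Borel subalgebra and the category \<open>\<O>\<close>\<close>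

text \<open>
  Modules live on complex subspaces \<open>V\<close> of an ambient vector space with scalar multiplication
  \<open>scale\<close>; only the values \<open>act a v\<close> with \<open>a\<close> in the Borel subalgebra and \<open>v \<in> V\<close> matter.
\<close>

definition borel_module ::
  "twisted \<Rightarrow> (complex \<Rightarrow> 'v::ab_group_add \<Rightarrow> 'v) \<Rightarrow> (falg set \<Rightarrow> 'v \<Rightarrow> 'v) \<Rightarrow> 'v set \<Rightarrow> bool" where
  "borel_module T scale act V \<longleftrightarrow>
     module.subspace scale V \<and>
     (\<forall>a\<in>borel T. \<forall>v\<in>V. act a v \<in> V) \<and>
     (\<forall>a\<in>borel T. \<forall>v\<in>V. \<forall>w\<in>V. act a (v + w) = act a v + act a w) \<and>
     (\<forall>a\<in>borel T. \<forall>b\<in>borel T. \<forall>v\<in>V. act (a \<oplus>\<^bsub>UL T\<^esub> b) v = act a v + act b v) \<and>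
     (\<forall>a\<in>borel T. \<forall>b\<in>borel T. \<forall>v\<in>V. act (a \<otimes>\<^bsub>UL T\<^esub> b) v = act a (act b v)) \<and>
     (\<forall>c. \<forall>v\<in>V. act (scU T c) v = scale c v)"

definition torus_chars :: "twisted \<Rightarrow> (falg set \<Rightarrow> complex) set" where
  "torus_chars T = {\<chi>.
     (\<forall>c. \<chi> (scU T c) = c) \<and>
     (\<forall>a\<in>torus T. \<forall>b\<in>torus T. \<chi> (a \<oplus>\<^bsub>UL T\<^esub> b) = \<chi> a + \<chi> b) \<and>
     (\<forall>a\<in>torus T. \<forall>b\<in>torus T. \<chi> (a \<otimes>\<^bsub>UL T\<^esub> b) = \<chi> a * \<chi> b)}"

text \<open>
  Addition of characters is multiplication of their values at the \<open>k\<^sub>j\<close>, so \<open>\<mu> - \<lambda>\<close> is the sum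
  of the \<open>n\<^sub>i \<alpha>\<^sub>i\<close>, where \<open>\<alpha>\<^sub>i\<close> takes the value \<open>qi T (Some i) powi csig T (Some i) (Some j)\<close>
  at \<open>k\<^sub>j\<close>, iff the following holds.
\<close>

definition wt_le :: "twisted \<Rightarrow> (falg set \<Rightarrow> complex) \<Rightarrow> (falg set \<Rightarrow> complex) \<Rightarrow> bool" where
  "wt_le T \<chi> \<mu> \<longleftrightarrow> (\<exists>n :: nat \<Rightarrow> nat. \<forall>j\<in>reps T.
     \<mu> (kU T (Some j)) = \<chi> (kU T (Some j))
       * (\<Prod>i\<in>reps T. (qi T (Some i) powi csig T (Some i) (Some j)) ^ n i))"

definition cone :: "twisted \<Rightarrow> (falg set \<Rightarrow> complex) \<Rightarrow> (falg set \<Rightarrow> complex) set" where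
  "cone T \<chi> = {\<mu> \<in> torus_chars T. wt_le T \<mu> \<chi>}"

definition wt_space ::
  "twisted \<Rightarrow> (complex \<Rightarrow> 'v::ab_group_add \<Rightarrow> 'v) \<Rightarrow> (falg set \<Rightarrow> 'v \<Rightarrow> 'v) \<Rightarrow> 'v set
     \<Rightarrow> (falg set \<Rightarrow> complex) \<Rightarrow> 'v set" where
  "wt_space T scale act V \<chi> = {v \<in> V. \<forall>a\<in>torus T. act a v = scale (\<chi> a) v}"

definition in_category_O ::
  "twisted \<Rightarrow> (complex \<Rightarrow> 'v::ab_group_add \<Rightarrow> 'v) \<Rightarrow> (falg set \<Rightarrow> 'v \<Rightarrow> 'v) \<Rightarrow> 'v set \<Rightarrow> bool" where
  "in_category_O T scale act V \<longleftrightarrow>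
     borel_module T scale act V \<and>
     module.span scale (\<Union>\<chi>\<in>torus_chars T. wt_space T scale act V \<chi>) = V \<and>
     (\<forall>\<chi>\<in>torus_chars T. \<exists>B. finite B \<and> module.span scale B = wt_space T scale act V \<chi>) \<and>
     (\<exists>S. finite S \<and> S \<subseteq> torus_chars T \<and>
        {\<chi> \<in> torus_chars T. wt_space T scale act V \<chi> \<noteq> {0}} \<subseteq> (\<Union>\<chi>\<in>S. cone T \<chi>))"

definition simple_in_O ::
  "twisted \<Rightarrow> (complex \<Rightarrow> 'v::ab_group_add \<Rightarrow> 'v) \<Rightarrow> (falg set \<Rightarrow> 'v \<Rightarrow> 'v) \<Rightarrow> 'v set \<Rightarrow> bool" where
  "simple_in_O T scale act V \<longleftrightarrow>
     in_category_O T scale act V \<and> V \<noteq> {0} \<and>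
     (\<forall>W. W \<subseteq> V \<and> in_category_O T scale act W \<longrightarrow> W = {0} \<or> W = V)"

definition l_highest_weight ::
  "twisted \<Rightarrow> (pm \<Rightarrow> nat \<Rightarrow> int \<Rightarrow> falg set) \<Rightarrow> (nat \<Rightarrow> int \<Rightarrow> falg set)
     \<Rightarrow> (complex \<Rightarrow> 'v::ab_group_add \<Rightarrow> 'v) \<Rightarrow> (falg set \<Rightarrow> 'v \<Rightarrow> 'v) \<Rightarrow> 'v set \<Rightarrow> bool" where
  "l_highest_weight T x h scale act V \<longleftrightarrow>
     borel_module T scale act V \<and>
     (\<exists>v\<in>V. (\<lambda>a. act a v) ` borel T = V \<and>
        (\<exists>\<gamma> :: nat \<Rightarrow> complex fps. \<forall>i\<in>nodes (dyn T). \<forall>r::nat.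
           act (x Plus i (int r)) v = 0 \<and>
           act (phiU T h Plus i (int r)) v = scale (fps_nth (\<gamma> i) r) v))"

end

theory Submission
  imports Defs "HOL-Computational_Algebra.Fundamental_Theorem_Algebra"
begin

text \<open>
  Choose a weight \<open>\<chi>\<close> of \<open>V\<close> such that no \<open>\<chi> + \<alpha>\<^sub>i\<close> is a weight. Every \<open>x\<^sub>i\<^sub>,\<^sub>r\<^sup>+\<close> kills the weight space
  of \<open>\<chi>\<close>, and the \<open>\<phi>\<^sub>i\<^sub>,\<^sub>r\<^sup>+\<close> act on it by commuting operators. It is finite-dimensional, so it
  contains a common eigenvector \<open>v\<close>. The submodule generated by \<open>v\<close> is spanned by weight vectors
  and thus lies in \<open>\<O>\<close>; by simplicity it is \<open>V\<close>.

  Such a \<open>\<chi>\<close> exists because of the multiplicative function \<open>\<Prod>\<^sub>j \<chi>(k\<^sub>j)^c\<^sub>j\<close> of \<open>\<chi>\<close>, where \<open>c\<close> is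
  a multiple of \<open>2\<rho>\<^sup>\<or>\<close>: every \<open>\<alpha>\<^sub>i\<close> multiplies it by the same positive power of \<open>q\<close>, which has infinite
  order. On the union of finitely many cones \<open>D(\<lambda>\<^sub>s)\<close> it can therefore be raised only finitely often.
\<close>


section \<open>Common eigenvectors\<close>

locale complex_vector_space = vector_space scale
  for scale :: "complex \<Rightarrow> 'v::ab_group_add \<Rightarrow> 'v"
begin

text \<open>A basis of \<open>U\<close> together with a vector of \<open>W\<close> outside
  \<open>U\<close> is independent, so it has at most \<open>card B\<close> elements. The size of a
  spanning set thus serves as the measure for inductions over finite-dimensional spaces.\<close>

lemma proper_subspace_card:
  assumes "finite B" "span B = W" "subspace U" "U \<subseteq> W" "U \<noteq> W"
  shows "\<exists>B'. finite B' \<and> span B' = U \<and> card B' < card B"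
proof -
  obtain B' where B': "B' \<subseteq> U" "independent B'" "U \<subseteq> span B'"
    by (rule maximal_independent_subset)
  have sp: "span B' = U"
    using B' assms(3) by (simp add: antisym span_minimal)
  obtain w where w: "w \<in> W" "w \<notin> U" using assms by blast
  have ind: "independent (insert w B')"
    using B' w sp by (simp add: independent_insert)
  have "insert w B' \<subseteq> span B" using B' w assms by blast
  then have "finite (insert w B') \<and> card (insert w B') \<le> card B"
    by (rule independent_span_bound[OF assms(1) ind])
  moreover have "w \<notin> B'" using B'(1) w by blast
  ultimately show ?thesis using sp by (intro exI[of _ B']) auto
qed

text \<open>Relative to \<open>W\<close> because the operators \<open>act a\<close> are controlled
  only on the module; outside it they may be arbitrary functions.\<close>

definition linear_within :: "'v set \<Rightarrow> ('v \<Rightarrow> 'v) \<Rightarrow> bool" where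
  "linear_within W f \<longleftrightarrow> f ` W \<subseteq> W \<and> (\<forall>v\<in>W. \<forall>w\<in>W. f (v + w) = f v + f w)
     \<and> (\<forall>c. \<forall>v\<in>W. f (scale c v) = scale c (f v))"

text \<open>The vector p(f) v, evaluated by Horner's scheme.\<close>

definition poly_app :: "('v \<Rightarrow> 'v) \<Rightarrow> 'v \<Rightarrow> complex poly \<Rightarrow> 'v" where
  "poly_app f v p = fold_coeffs (\<lambda>a w. scale a v + f w) p 0"

context
  fixes W f v
  assumes W: "subspace W" and lin: "linear_within W f" and v: "v \<in> W"
begin

lemma linear_within_0: "f 0 = 0"
proof -
  have "f (scale 0 v) = scale 0 (f v)" using lin v unfolding linear_within_def by blast
  then show ?thesis by simp
qed

lemma poly_app_0: "poly_app f v 0 = 0"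
  by (simp add: poly_app_def)

lemma poly_app_pCons: "poly_app f v (pCons a p) = scale a v + f (poly_app f v p)"
\<comment> \<open>\<open>pCons 0 0\<close> is the zero polynomial, whose coefficient list is empty,
  so the fold does not unfold there; the equation then rests on f 0 = 0.\<close>
proof (cases "a = 0 \<and> p = 0")
  case True
  then show ?thesis by (simp add: poly_app_def linear_within_0)
next
  case False
  then show ?thesis by (auto simp: poly_app_def)
qed

lemma poly_app_in: "poly_app f v p \<in> W"
proof (induction p)
  case 0
  then show ?case using W by (simp add: poly_app_0 subspace_0)
next
  case (pCons a p)
  then have "f (poly_app f v p) \<in> W" using lin unfolding linear_within_def by blast
  then show ?case using W v by (simp add: poly_app_pCons subspace_add subspace_scale)
qed

lemma poly_app_add: "poly_app f v (p + q) = poly_app f v p + poly_app f v q"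
proof (induction p q rule: poly_induct2)
  case 0
  then show ?case by (simp add: poly_app_0)
next
  case (pCons a p b q)
  have "f (poly_app f v p + poly_app f v q) = f (poly_app f v p) + f (poly_app f v q)"
    using lin poly_app_in unfolding linear_within_def by blast
  then show ?case using pCons by (simp add: poly_app_pCons algebra_simps scale_left_distrib)
qed

lemma poly_app_smult: "poly_app f v (smult c p) = scale c (poly_app f v p)"
proof (induction p)
  case 0
  then show ?case by (simp add: poly_app_0)
next
  case (pCons a p)
  have "f (scale c (poly_app f v p)) = scale c (f (poly_app f v p))"
    using lin poly_app_in unfolding linear_within_def by blast
  then show ?case using pCons by (simp add: poly_app_pCons scale_right_distrib)
qed

lemma poly_app_sum: "poly_app f v (sum g A) = (\<Sum>i\<in>A. poly_app f v (g i))"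
  by (induction A rule: infinite_finite_induct) (simp_all add: poly_app_0 poly_app_add)

text \<open>The \<open>card B + 1\<close> vectors v, f v, f^2 v, ... lie in the span of
  \<open>B\<close>, so they satisfy a linear relation, whose coefficients are those of
  \<open>p\<close>.\<close>

lemma poly_app_annihilator:
  assumes "finite B" "span B = W"
  shows "\<exists>p. p \<noteq> 0 \<and> poly_app f v p = 0"
proof -
  define e where "e n = poly_app f v (monom 1 n)" for n
  show ?thesis
  \<comment> \<open>Dependence is a property of sets and misses a repetition among the powers. A
    repetition gives a difference of two monomials.\<close>
  proof (cases "inj_on e {..card B}")
    case False
    then obtain i j where ij: "i \<noteq> j" "e i = e j" unfolding inj_on_def by blast
    define p where "p = monom (1::complex) i + smult (- 1) (monom 1 j)"
    have "coeff p i = 1" using ij by (simp add: p_def)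
    then have "p \<noteq> 0" by auto
    moreover have "poly_app f v p = 0"
      using ij unfolding p_def poly_app_add poly_app_smult by (simp add: e_def)
    ultimately show ?thesis by blast
  next
    case True
    then have "card (e ` {..card B}) = Suc (card B)" by (simp add: card_image)
    moreover have "e ` {..card B} \<subseteq> span B" using poly_app_in assms by (auto simp: e_def)
    ultimately have "dependent (e ` {..card B})"
      using independent_span_bound[OF assms(1)] by fastforce
    then obtain t u where t: "t \<subseteq> e ` {..card B}"
      and u: "(\<Sum>w\<in>t. scale (u w) w) = 0" "\<exists>w\<in>t. u w \<noteq> 0"
      unfolding dependent_explicit by blast
    obtain N where N: "N \<subseteq> {..card B}" "t = e ` N" using t by (meson subset_imageE)
    have inj: "inj_on e N" using True N inj_on_subset by blast
    have finN: "finite N" using N finite_subset by blast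
    define p where "p = (\<Sum>n\<in>N. smult (u (e n)) (monom 1 n))"
    have "poly_app f v p = 0"
      using u inj unfolding p_def poly_app_sum poly_app_smult N
      by (simp add: sum.reindex flip: e_def)
    moreover obtain n where n: "n \<in> N" "u (e n) \<noteq> 0" using u N by blast
    have "coeff p n = (\<Sum>k\<in>N. if k = n then u (e k) else 0)"
      by (auto simp: p_def coeff_sum intro!: sum.cong)
    then have "coeff p n = u (e n)"
      using finN n by simp
    then have "p \<noteq> 0" using n by auto
    ultimately show ?thesis by blast
  qed
qed

end

lemma subspace_eigenspace:
  assumes "subspace W" "linear_within W f"
  shows "subspace {v \<in> W. f v = scale c v}"
proof -
  have "f 0 = 0" using linear_within_0[OF assms subspace_0[OF assms(1)]] .
  then show ?thesis
    using assms unfolding linear_within_def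
    by (intro subspaceI)
       (auto simp: subspace_0 subspace_add subspace_scale scale_right_distrib ac_simps)
qed

text \<open>Split off a root: p = (X - z) q. Either q also annihilates v and has smaller degree, or
  q(f) v is an eigenvector for z.\<close>

lemma eigenvector_of_annihilator:
  assumes W: "subspace W" "linear_within W f" "v \<in> W" "v \<noteq> 0"
    and "p \<noteq> 0" "poly_app f v p = 0"
  shows "\<exists>c. \<exists>w\<in>W. w \<noteq> 0 \<and> f w = scale c w"
  using assms(5,6)
proof (induction "degree p" arbitrary: p rule: less_induct)
  case less
  note pCons = poly_app_pCons[OF W(1-3)]
  \<comment> \<open>A nonzero constant sends v to a nonzero vector, so \<open>p\<close> has positive
    degree and hence a complex root.\<close>
  have "degree p \<noteq> 0"
  proof
    assume "degree p = 0"
    then obtain a where "p = [:a:]" using degree_eq_zeroE by blast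
    then show False
      using less.prems W by (simp add: pCons poly_app_0[OF W(1-3)] linear_within_0[OF W(1-3)])
  qed
  then obtain z where "poly p z = 0"
    using fundamental_theorem_of_algebra by (metis constant_degree)
  then obtain q where q: "p = [:- z, 1:] * q" by (auto simp: poly_eq_0_iff_dvd)
  show ?case
  proof (cases "poly_app f v q = 0")
    case True
    have "q \<noteq> 0" using q less.prems by auto
    moreover have "degree q < degree p"
      using \<open>q \<noteq> 0\<close> by (simp add: q degree_mult_eq del: mult_pCons_left)
    ultimately show ?thesis using less True by blast
  next
    case False
    have "p = pCons 0 q + smult (- z) q" by (simp add: q)
    then have "poly_app f v p = f (poly_app f v q) + scale (- z) (poly_app f v q)"
      using W by (simp only: poly_app_add poly_app_smult pCons) simp
    then have "f (poly_app f v q) = scale z (poly_app f v q)"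
      using less.prems by simp
    then show ?thesis using False poly_app_in[OF W(1-3)] by blast
  qed
qed

lemma eigenvector_exists:
  assumes "finite B" "span B = W" "W \<noteq> {0}" "linear_within W f"
  shows "\<exists>c. \<exists>w\<in>W. w \<noteq> 0 \<and> f w = scale c w"
proof -
  have W: "subspace W" using assms by auto
  then obtain v where "v \<in> W" "v \<noteq> 0" using assms subspace_0 by blast
  then show ?thesis
    using W assms poly_app_annihilator eigenvector_of_annihilator by metis
qed

text \<open>If every operator is a scalar on \<open>W\<close>, any nonzero vector serves. Otherwise
  some \<open>f\<close> has a nonzero proper eigenspace, and by commutation the whole family
  preserves it. The induction is over the size of a spanning set, so \<open>F\<close> may be
  infinite.\<close>

lemma common_eigenvector:
  assumes "finite B" "span B = W" "W \<noteq> {0}"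
    and "\<And>f. f \<in> F \<Longrightarrow> linear_within W f"
    and "\<And>f g w. f \<in> F \<Longrightarrow> g \<in> F \<Longrightarrow> w \<in> W \<Longrightarrow> f (g w) = g (f w)"
  shows "\<exists>w\<in>W. w \<noteq> 0 \<and> (\<forall>f\<in>F. \<exists>c. f w = scale c w)"
  using assms
proof (induction "card B" arbitrary: B W rule: less_induct)
  case less
  have W: "subspace W" using less.prems by auto
  show ?case
  proof (cases "\<forall>f\<in>F. \<exists>c. \<forall>w\<in>W. f w = scale c w")
    case True
    obtain w where "w \<in> W" "w \<noteq> 0" using less.prems W subspace_0 by blast
    then show ?thesis using True by blast
  next
    case False
    then obtain f where f: "f \<in> F" "\<And>c. \<exists>w\<in>W. f w \<noteq> scale c w" by blast
    obtain c w where w: "w \<in> W" "w \<noteq> 0" "f w = scale c w"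
      using eigenvector_exists less.prems f by metis
    define U where "U = {v \<in> W. f v = scale c v}"
    have U: "subspace U" "U \<subseteq> W" "U \<noteq> W" "U \<noteq> {0}"
      using subspace_eigenspace[OF W] less.prems(4)[OF f(1)] f(2)[of c] w by (auto simp: U_def)
    obtain B' where B': "finite B'" "span B' = U" "card B' < card B"
      using proper_subspace_card[OF less.prems(1,2) U(1-3)] by blast
    have "linear_within U g" if "g \<in> F" for g
      using less.prems(4)[OF that] less.prems(5)[OF that f(1)] less.prems(5)[OF f(1) that]
      unfolding linear_within_def U_def by auto
    then have "\<exists>w\<in>U. w \<noteq> 0 \<and> (\<forall>f\<in>F. \<exists>c. f w = scale c w)"
      using less.hyps[OF B'(3,1,2)] U less.prems(5) U(2) by blast
    then show ?thesis using U by blast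
  qed
qed

end


section \<open>Cartan matrices and diagram automorphisms\<close>

lemma cartan_sym: "cartan X i j = cartan X j i"
  by (auto simp: cartan_def)

text \<open>Dynkin diagrams are trees. Needed for orbits of length three, whose nodes are either
  pairwise adjacent or pairwise non-adjacent.\<close>

lemma cartan_no_triangle:
  assumes "cartan X i j = - 1" "cartan X j k = - 1" "cartan X i k = - 1"
  shows False
  using assms by (cases X) (auto simp: cartan_def split: if_splits)

lemma finite_nodes: "finite (nodes X)"
  by (cases X) auto

text \<open>The quadratic 2 j (m + 1 - j) has second difference -4, and it vanishes at 0 and m + 1,
  so the neighbours missing at the two ends do no harm.\<close>

lemma sum_cartan_TypeA:
  assumes "i \<in> {1..m}"
  shows "(\<Sum>j\<in>{1..m}. cartan (TypeA m) i j * int (2 * j * (m + 1 - j))) = 4"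
proof -
  let ?c = "\<lambda>j. 2 * int j * (int m + 1 - int j)"
  \<comment> \<open>Row \<open>i\<close> has a diagonal entry and at most two neighbours; for
    \<open>i = 1\<close> the lower one would be 0, which lies outside the range.\<close>
  have "(\<Sum>j\<in>{1..m}. cartan (TypeA m) i j * int (2 * j * (m + 1 - j)))
    = (\<Sum>j\<in>{1..m}. (if j = i then 2 * ?c j else 0) - (if j = i + 1 then ?c j else 0)
        - (if j = i - 1 then ?c j else 0))"
    using assms by (intro sum.cong refl) (auto simp: cartan_def of_nat_diff)
  also have "\<dots> = 2 * ?c i - (if i + 1 \<le> m then ?c (i + 1) else 0)
      - (if 1 \<le> i - 1 then ?c (i - 1) else 0)"
    using assms by (auto simp: sum_subtractf sum.delta)
  also have "\<dots> = 4"
  proof -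
    have "(if i + 1 \<le> m then ?c (i + 1) else 0) = 2 * (int i + 1) * (int m - int i)"
      using assms by (cases "i = m") auto
    moreover have "(if 1 \<le> i - 1 then ?c (i - 1) else 0) = 2 * (int i - 1) * (int m + 2 - int i)"
      using assms by (cases "i = 1") (auto simp: of_nat_diff)
    ultimately show ?thesis by (simp add: algebra_simps)
  qed
  finally show ?thesis .
qed

text \<open>Along the chain the weights are the quadratic 2 j (2 m - 1 - j), with second difference
  -4 and value 0 at j = 0. Each tip of the fork carries half of the value of the quadratic at m - 1,
  so the two tips together replace the next node of the chain. The row of a tip is a direct
  computation.\<close>

lemma sum_cartan_TypeD:
  assumes "m \<ge> 4" "i \<in> {1..m}"
  shows "(\<Sum>j\<in>{1..m}. cartan (TypeD m) i j *
    int (if j + 2 \<le> m then 2 * j * (2 * m - 1 - j) else m * (m - 1))) = 4"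
proof -
  define c :: "nat \<Rightarrow> int" where
    "c j = int (if j + 2 \<le> m then 2 * j * (2 * m - 1 - j) else m * (m - 1))" for j
  \<comment> \<open>The last two terms come from the edge between m - 2 and m, the two before them
    from the chain 1, ..., m - 1.\<close>
  have "(\<Sum>j\<in>{1..m}. cartan (TypeD m) i j * c j)
    = (\<Sum>j\<in>{1..m}. (if j = i then 2 * c j else 0)
        - (if j = i + 1 then if i + 1 < m then c j else 0 else 0)
        - (if j = i - 1 then if i < m then c j else 0 else 0)
        - (if j = m then if i + 2 = m then c j else 0 else 0)
        - (if j = m - 2 then if i = m then c j else 0 else 0))"
  proof (intro sum.cong refl)
    fix j assume j: "j \<in> {1..m}"
    consider "j = i" | "j = i + 1" | "j = i - 1" "j \<noteq> i" | "j \<noteq> i" "j \<noteq> i + 1" "j \<noteq> i - 1"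
      by blast
    then show "cartan (TypeD m) i j * c j = (if j = i then 2 * c j else 0)
        - (if j = i + 1 then if i + 1 < m then c j else 0 else 0)
        - (if j = i - 1 then if i < m then c j else 0 else 0)
        - (if j = m then if i + 2 = m then c j else 0 else 0)
        - (if j = m - 2 then if i = m then c j else 0 else 0)"
      by cases (use assms j in \<open>auto simp: cartan_def\<close>)
  qed
  also have "\<dots> = 2 * c i
        - (if i + 1 < m then c (i + 1) else 0)
        - (if 1 \<le> i - 1 \<and> i < m then c (i - 1) else 0)
        - (if i + 2 = m then c m else 0)
        - (if i = m then c (m - 2) else 0)"
    using assms by (auto simp: sum_subtractf sum.delta)
  also have "\<dots> = 4"
  proof -
    have spine: "c j = 2 * int j * (2 * int m - 1 - int j)" if "j + 2 \<le> m" for j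
      using that by (simp add: c_def of_nat_diff)
    have fork: "c j = int m * (int m - 1)" if "\<not> j + 2 \<le> m" for j
      using that assms by (simp add: c_def of_nat_diff)
    consider "i = m" | "i + 1 = m" | "i + 2 = m" | "i = 1" "i + 3 \<le> m" | "i \<ge> 2" "i + 3 \<le> m"
      using assms by fastforce
    then show ?thesis
    proof cases
      case 1
      then show ?thesis using assms by (simp add: spine fork of_nat_diff algebra_simps)
    next
      case 2
      then have m: "m = Suc i" by simp
      then show ?thesis using assms by (auto simp: m spine fork of_nat_diff algebra_simps)
    next
      case 3
      then have m: "m = Suc (Suc i)" by simp
      then show ?thesis using assms by (auto simp: m spine fork of_nat_diff algebra_simps)
    next
      case 4
      then show ?thesis using assms by (simp add: spine fork of_nat_diff algebra_simps)
    next
      case 5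
      then show ?thesis using assms by (auto simp: spine fork of_nat_diff algebra_simps)
    qed
  qed
  finally show ?thesis unfolding c_def .
qed

text \<open>The entries are twice the coefficients 16, 22, 30, 42, 30, 16 of the sum of the positive
  roots; the leading 0 is padding, as nodes are counted from 1.\<close>

lemma sum_cartan_TypeE6:
  assumes "i \<in> {1..6}"
  shows "(\<Sum>j\<in>{1..6}. cartan TypeE6 i j * int ([0, 32, 44, 60, 84, 60, 32] ! j)) = 4"
proof -
  have "{1..6} = {1, 2, 3, 4, 5, 6::nat}" by auto
  then show ?thesis using assms by (auto simp: cartan_def)
qed

text \<open>The witness is \<open>4\<rho>\<^sup>\<or>\<close>.\<close>

lemma cartan_height_weights:
  assumes "admissible X"
  obtains c :: "nat \<Rightarrow> nat" where "\<And>i. i \<in> nodes X \<Longrightarrow> (\<Sum>j\<in>nodes X. cartan X i j * int (c j)) = 4"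
proof (cases X)
  case (TypeA m)
  show ?thesis
  proof (rule that)
    show "(\<Sum>j\<in>nodes X. cartan X i j * int (2 * j * (m + 1 - j))) = 4"
      if "i \<in> nodes X" for i
      using that assms unfolding TypeA nodes.simps admissible.simps by (intro sum_cartan_TypeA)
  qed
next
  case (TypeD m)
  show ?thesis
  proof (rule that)
    show "(\<Sum>j\<in>nodes X. cartan X i j * int (if j + 2 \<le> m then 2 * j * (2 * m - 1 - j) else m * (m - 1))) = 4"
      if "i \<in> nodes X" for i
      using that assms unfolding TypeD nodes.simps admissible.simps by (intro sum_cartan_TypeD)
  qed
next
  case TypeE6
  show ?thesis
  proof (rule that)
    show "(\<Sum>j\<in>nodes X. cartan X i j * int ([0, 32, 44, 60, 84, 60, 32] ! j)) = 4"
      if "i \<in> nodes X" for i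
      using that assms unfolding TypeE6 nodes.simps admissible.simps by (intro sum_cartan_TypeE6)
  qed
qed

lemma prod_power_int:
  fixes p :: "'a::field"
  assumes "p \<noteq> 0"
  shows "(\<Prod>j\<in>A. (p powi a j) ^ c j) = p powi (\<Sum>j\<in>A. a j * int (c j))"
  using assms
  by (induction A rule: infinite_finite_induct)
     (simp_all add: power_int_add power_int_mult)

section \<open>Orbit sums of the Cartan matrix\<close>

context twisted_data begin

lemma sigma_in_nodes: "i \<in> nodes (dyn T) \<Longrightarrow> (sigma T ^^ r) i \<in> nodes (dyn T)"
  using sigma_permutes by (induction r) (auto simp: permutes_in_image)

lemma cartan_sigma_pow:
  "i \<in> nodes (dyn T) \<Longrightarrow> j \<in> nodes (dyn T) \<Longrightarrow>
    cartan (dyn T) ((sigma T ^^ r) i) ((sigma T ^^ r) j) = cartan (dyn T) i j"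
  by (induction r) (simp_all add: sigma_cartan sigma_in_nodes)

lemma csum_2: "aut_order T = 2 \<Longrightarrow>
    csum T i j = cartan (dyn T) i (sigma T j) + cartan (dyn T) i j"
  using sigma_order by (simp add: csum_def numeral_2_eq_2)

lemma csum_3: "aut_order T = 3 \<Longrightarrow>
    csum T i j = cartan (dyn T) i (sigma T j) + cartan (dyn T) i (sigma T (sigma T j))
      + cartan (dyn T) i j"
  using sigma_order by (simp add: csum_def numeral_3_eq_3)

lemma sigma_2: "aut_order T = 2 \<Longrightarrow> sigma T (sigma T i) = i"
  using sigma_order[of i] by (simp add: numeral_2_eq_2)

lemma sigma_3: "aut_order T = 3 \<Longrightarrow> sigma T (sigma T (sigma T i)) = i"
  using sigma_order[of i] by (simp add: numeral_3_eq_3)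

text \<open>As \<sigma>^M = 1, replacing j by \<sigma> j permutes the summands cyclically.\<close>

lemma csum_sigma: "csum T i (sigma T j) = csum T i j"
  using order_cases by (auto simp: csum_2 csum_3 sigma_2 sigma_3)

text \<open>C(i, \<sigma>^r j) = C(j, \<sigma>^(M-r) i) by symmetry and invariance of C, so the two
  sums have the same terms in a different order.\<close>

lemma csum_sym:
  assumes "i \<in> nodes (dyn T)" "j \<in> nodes (dyn T)"
  shows "csum T i j = csum T j i"
proof -
  have n: "sigma T i \<in> nodes (dyn T)" "sigma T j \<in> nodes (dyn T)"
    using assms sigma_in_nodes[of _ 1] by auto
  have "cartan (dyn T) i (sigma T j) = cartan (dyn T) j (sigma T i)" if "aut_order T = 2"
    using sigma_cartan[of i "sigma T j"] sigma_2[OF that] assms n by (metis cartan_sym)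
  moreover have "cartan (dyn T) i (sigma T j) = cartan (dyn T) j (sigma T (sigma T i))"
    if "aut_order T = 3"
    using sigma_cartan[of i "sigma T j"] sigma_cartan[of "sigma T i" "sigma T (sigma T j)"]
      sigma_3[OF that] assms n sigma_in_nodes[of _ 1]
    by (metis cartan_sym funpow_0 funpow_simps_right(2) o_apply One_nat_def)
  moreover have "cartan (dyn T) i (sigma T (sigma T j)) = cartan (dyn T) j (sigma T i)"
    if "aut_order T = 3"
    using sigma_cartan[of i "sigma T (sigma T j)"] sigma_3[OF that] assms n sigma_in_nodes[of _ 1]
    by (metis cartan_sym funpow_0 funpow_simps_right(2) o_apply One_nat_def)
  ultimately show ?thesis
    using order_cases cartan_sym[of "dyn T" i j] by (auto simp: csum_2 csum_3)
qed

lemma orb_eq_funpow: obtains r where "orb T i = (sigma T ^^ r) i"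
proof -
  have "orb T i \<in> (\<lambda>r. (sigma T ^^ r) i) ` {..<aut_order T}"
    unfolding orb_def using order_cases by (intro Min_in) (auto simp: lessThan_empty_iff)
  then show ?thesis using that by blast
qed

lemma csum_orb: "csum T i (orb T j) = csum T i j"
proof -
  have "csum T i ((sigma T ^^ r) j) = csum T i j" for r
    by (induction r) (simp_all add: csum_sigma)
  then show ?thesis by (metis orb_eq_funpow)
qed

lemma orb_sigma: "orb T (sigma T i) = orb T i"
proof -
  have *: "{..<2} = {0, 1::nat}" "{..<3} = {0, 1, 2::nat}" by auto
  have sq: "(sigma T ^^ 2) k = sigma T (sigma T k)" for k by (simp add: numeral_2_eq_2)
  consider "aut_order T = 2" | "aut_order T = 3" using order_cases by blast
  then have "(\<lambda>r. (sigma T ^^ r) (sigma T i)) ` {..<aut_order T}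
      = (\<lambda>r. (sigma T ^^ r) i) ` {..<aut_order T}"
    by cases (simp_all add: * sq sigma_2 sigma_3 insert_commute)
  then show ?thesis by (simp add: orb_def)
qed

lemma orb_orb: "orb T (orb T i) = orb T i"
proof -
  have "orb T ((sigma T ^^ r) i) = orb T i" for r
    by (induction r) (simp_all add: orb_sigma)
  then show ?thesis by (metis orb_eq_funpow)
qed

lemma orb_in_reps: "i \<in> nodes (dyn T) \<Longrightarrow> orb T i \<in> reps T"
  by (simp add: reps_def)

lemma orb_reps: "i \<in> reps T \<Longrightarrow> orb T i = i"
  by (auto simp: reps_def orb_orb)

lemma reps_subset: "reps T \<subseteq> nodes (dyn T)"
  unfolding reps_def by (metis image_subsetI orb_eq_funpow sigma_in_nodes)

text \<open>This makes the division in \<open>csig\<close> exact. At a fixed node i the summands are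
  equal, so \<open>csum T i i\<close> is 2 M and \<open>csum T i j\<close> is M C(i, j). At any
  other node \<open>csum T i i\<close> is 1 or 2.\<close>

lemma csum_diag_dvd:
  assumes "i \<in> nodes (dyn T)" "j \<in> nodes (dyn T)"
  shows "csum T i i dvd 2 * csum T i j"
proof (cases "sigma T i = i")
  case True
  have n: "sigma T j \<in> nodes (dyn T)"
    using assms sigma_in_nodes[of _ 1] by auto
  have "cartan (dyn T) i (sigma T j) = cartan (dyn T) i j"
    and "cartan (dyn T) i (sigma T (sigma T j)) = cartan (dyn T) i j"
    using sigma_cartan[of i j] sigma_cartan[of i "sigma T j"] True assms n by auto
  moreover have "cartan (dyn T) i i = 2" by (simp add: cartan_def)
  ultimately show ?thesis using order_cases True by (auto simp: csum_2 csum_3)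
next
  case False
  have diag: "cartan (dyn T) i i = 2" by (simp add: cartan_def)
  have n: "sigma T i \<in> nodes (dyn T)" "sigma T (sigma T i) \<in> nodes (dyn T)"
    using assms sigma_in_nodes[of _ 1] sigma_in_nodes[of _ 2] by (auto simp: numeral_2_eq_2)
  have val: "cartan (dyn T) i (sigma T i) = - 1 \<or> cartan (dyn T) i (sigma T i) = 0"
    using False by (simp add: cartan_def)
  \<comment> \<open>The value 1 arises when i and \<sigma> i are adjacent, which can happen only for
    M = 2.\<close>
  have "csum T i i = 1 \<or> csum T i i = 2"
  proof (cases "aut_order T = 2")
    case True
    then show ?thesis using val diag by (auto simp: csum_2)
  next
    case False
    then have 3: "aut_order T = 3" using order_cases by auto
    \<comment> \<open>By rotation the three pairs in the orbit have the same entry, which must be 0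
      since the diagram has no triangle.\<close>
    have "cartan (dyn T) (sigma T i) (sigma T (sigma T i)) = cartan (dyn T) i (sigma T i)"
      using sigma_cartan n assms by blast
    moreover have "cartan (dyn T) (sigma T (sigma T i)) (sigma T (sigma T (sigma T i)))
        = cartan (dyn T) (sigma T i) (sigma T (sigma T i))"
      using sigma_cartan n by blast
    ultimately have eq: "cartan (dyn T) i (sigma T (sigma T i)) = cartan (dyn T) i (sigma T i)"
      "cartan (dyn T) (sigma T i) (sigma T (sigma T i)) = cartan (dyn T) i (sigma T i)"
      using sigma_3[OF 3] cartan_sym by metis+
    then have "cartan (dyn T) i (sigma T i) = 0"
      using val cartan_no_triangle by metis
    then show ?thesis using eq diag 3 by (simp add: csum_3)
  qed
  then show ?thesis by auto
qed

text \<open>Both sides are \<open>qhalf T\<close> to the power 2 \<open>csum T i j\<close>, because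
  \<open>csum T i i\<close> is 2 d_i. This rewrites the roots in \<open>wt_le\<close> through the
  symmetric form.\<close>

lemma qi_powi_csig:
  assumes "i \<in> nodes (dyn T)" "j \<in> nodes (dyn T)"
  shows "qi T (Some i) powi csig T (Some i) (Some j) = qpar T powi csum T i j"
proof -
  have "csum T i i * csig T (Some i) (Some j) = 2 * csum T i j"
    using csum_diag_dvd[OF assms] by (simp add: csig_def)
  then have "qi T (Some i) powi csig T (Some i) (Some j) = qhalf T powi (2 * csum T i j)"
    by (simp add: qi_def flip: power_int_mult)
  also have "\<dots> = qpar T powi csum T i j"
    by (simp add: power_int_mult qpar_def)
  finally show ?thesis .
qed

text \<open>Since C(i, \<sigma>^r j) = C(\<sigma>^(-r) i, j), each of the M shifts contributes a
  weighted row sum of the Cartan matrix, which is 4. So the weights for the untwisted matrix can be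
  kept.\<close>

lemma csum_height_weights:
  obtains c :: "nat \<Rightarrow> nat" where "\<And>i. i \<in> nodes (dyn T) \<Longrightarrow>
    (\<Sum>j\<in>nodes (dyn T). csum T i j * int (c j)) = 4 * int (aut_order T)"
proof -
  obtain c :: "nat \<Rightarrow> nat" where
    c: "\<And>i. i \<in> nodes (dyn T) \<Longrightarrow> (\<Sum>j\<in>nodes (dyn T). cartan (dyn T) i j * int (c j)) = 4"
    using cartan_height_weights[OF dyn_admissible] by blast
  have "(\<Sum>j\<in>nodes (dyn T). csum T i j * int (c j)) = 4 * int (aut_order T)"
    if i: "i \<in> nodes (dyn T)" for i
  proof -
    \<comment> \<open>\<sigma>^(M-r) serves as the inverse of \<sigma>^r.\<close>
    have shift: "cartan (dyn T) i ((sigma T ^^ r) j)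
        = cartan (dyn T) ((sigma T ^^ (aut_order T - r)) i) j"
      if "r \<in> {1..aut_order T}" "j \<in> nodes (dyn T)" for r j
    proof -
      have "(sigma T ^^ (aut_order T - r)) ((sigma T ^^ r) j) = j"
        using that sigma_order by (simp flip: funpow_add[THEN fun_cong, simplified])
      then show ?thesis
        using cartan_sigma_pow[OF i, of "(sigma T ^^ r) j" "aut_order T - r"] that sigma_in_nodes
        by simp
    qed
    have "(\<Sum>j\<in>nodes (dyn T). csum T i j * int (c j))
        = (\<Sum>r = 1..aut_order T. \<Sum>j\<in>nodes (dyn T). cartan (dyn T) i ((sigma T ^^ r) j) * int (c j))"
      unfolding csum_def sum_distrib_right by (rule sum.swap)
    also have "\<dots> = (\<Sum>r = 1..aut_order T. 4)"
      using shift c sigma_in_nodes[OF i] by (intro sum.cong refl) simp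
    finally show ?thesis by simp
  qed
  then show ?thesis using that by blast
qed

end


section \<open>The algebra and its commuting elements\<close>

lemma fscal_in_free_alg: "fscal c \<in> carrier (free_alg T)"
  by (simp add: free_alg_def fscal_def)

lemma fgen_in_free_alg: "g \<in> gens T \<Longrightarrow> fgen g \<in> carrier (free_alg T)"
  by (simp add: free_alg_def fgen_def)

lemma one_in_free_alg: "1 \<in> carrier (free_alg T)"
  using fscal_in_free_alg[of 1] by (simp add: fscal_def flip: zero_list_def)

lemma zero_in_free_alg: "0 \<in> carrier (free_alg T)"
  by (simp add: free_alg_def)

lemma add_in_free_alg:
  "p \<in> carrier (free_alg T) \<Longrightarrow> r \<in> carrier (free_alg T) \<Longrightarrow> p + r \<in> carrier (free_alg T)"
  using keys_add[of p r] by (auto simp: free_alg_def)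

lemma diff_in_free_alg:
  "p \<in> carrier (free_alg T) \<Longrightarrow> r \<in> carrier (free_alg T) \<Longrightarrow> p - r \<in> carrier (free_alg T)"
  using keys_diff[of p r] by (auto simp: free_alg_def)

lemma mult_in_free_alg:
  assumes "p \<in> carrier (free_alg T)" "r \<in> carrier (free_alg T)"
  shows "p * r \<in> carrier (free_alg T)"
proof -
  have "set w \<subseteq> gens T" if w: "w \<in> Poly_Mapping.keys (p * r)" for w
  proof -
    obtain a b where "w = a + b" "a \<in> Poly_Mapping.keys p" "b \<in> Poly_Mapping.keys r"
      using w keys_mult[of p r] by blast
    then show ?thesis using assms by (auto simp: plus_list_def free_alg_def)
  qed
  then show ?thesis by (simp add: free_alg_def)
qed

lemma power_in_free_alg: "p \<in> carrier (free_alg T) \<Longrightarrow> p ^ n \<in> carrier (free_alg T)"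
  by (induction n) (simp_all add: one_in_free_alg mult_in_free_alg)

lemma sum_in_free_alg:
  "(\<And>i. i \<in> A \<Longrightarrow> f i \<in> carrier (free_alg T)) \<Longrightarrow> sum f A \<in> carrier (free_alg T)"
  by (induction A rule: infinite_finite_induct) (simp_all add: zero_in_free_alg add_in_free_alg)

lemma prod_list_in_free_alg:
  "(\<And>p. p \<in> set ps \<Longrightarrow> p \<in> carrier (free_alg T)) \<Longrightarrow> prod_list ps \<in> carrier (free_alg T)"
  by (induction ps) (simp_all add: one_in_free_alg mult_in_free_alg)

lemmas free_alg_closed = fscal_in_free_alg fgen_in_free_alg one_in_free_alg zero_in_free_alg
  add_in_free_alg diff_in_free_alg mult_in_free_alg power_in_free_alg sum_in_free_alg
  prod_list_in_free_alg

lemma free_alg_simps: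
  "mult (free_alg T) = (*)" "one (free_alg T) = 1" "zero (free_alg T) = 0" "add (free_alg T) = (+)"
  by (simp_all add: free_alg_def)

lemma ring_free_alg: "ring (free_alg T)"
proof (rule ringI)
  show "abelian_group (free_alg T)"
  proof (rule abelian_groupI)
    fix p assume "p \<in> carrier (free_alg T)"
    then show "\<exists>r\<in>carrier (free_alg T). r \<oplus>\<^bsub>free_alg T\<^esub> p = \<zero>\<^bsub>free_alg T\<^esub>"
      using diff_in_free_alg[of 0 T p] zero_in_free_alg
      by (intro bexI[of _ "- p"]) (auto simp: free_alg_simps)
  qed (auto simp: free_alg_simps free_alg_closed algebra_simps)
  show "Group.monoid (free_alg T)"
    by (rule monoidI) (auto simp: free_alg_simps free_alg_closed algebra_simps)
qed (auto simp: free_alg_simps algebra_simps)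

lemma free_alg_minus:
  assumes "p \<in> carrier (free_alg T)" "r \<in> carrier (free_alg T)"
  shows "p \<ominus>\<^bsub>free_alg T\<^esub> r = p - r"
proof -
  interpret ring "free_alg T" by (rule ring_free_alg)
  have "- r \<in> carrier (free_alg T)"
    using assms by (simp add: free_alg_def)
  then have "\<ominus>\<^bsub>free_alg T\<^esub> r = - r"
    using assms by (intro minus_equality) (simp_all add: free_alg_simps)
  then show ?thesis by (simp add: a_minus_def free_alg_simps)
qed

lemma gens_affine:
  "i \<in> affine_nodes T \<Longrightarrow> E s i \<in> gens T"
  "i \<in> affine_nodes T \<Longrightarrow> K i \<in> gens T"
  "i \<in> affine_nodes T \<Longrightarrow> Kinv i \<in> gens T"
  by (cases s; auto simp: gens_def)+

lemma affine_nodes_simps: "None \<in> affine_nodes T" "i \<in> reps T \<Longrightarrow> Some i \<in> affine_nodes T"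
  by (auto simp: affine_nodes_def)

lemma relations_in_free_alg: "relations T \<subseteq> carrier (free_alg T)"
proof -
  have "finite (reps T)" by (simp add: reps_def finite_nodes)
  then show ?thesis
    unfolding relations_def serre_def Let_def
    by (auto intro!: free_alg_closed gens_affine affine_nodes_simps)
qed

section \<open>The quotient by the defining relations\<close>

lemma ideal_rel_ideal: "ideal (rel_ideal T) (free_alg T)"
  unfolding rel_ideal_def
  using ring.genideal_ideal[OF ring_free_alg relations_in_free_alg] .

interpretation UL: ring "UL T" for T
  unfolding UL_def by (rule ideal.quotient_is_ring[OF ideal_rel_ideal])

lemma cls_hom: "cls T \<in> ring_hom (free_alg T) (UL T)"
  using ideal.rcos_ring_hom[OF ideal_rel_ideal] unfolding UL_def cls_def .

lemma cls_closed: "p \<in> carrier (free_alg T) \<Longrightarrow> cls T p \<in> carrier (UL T)"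
  using ring_hom_closed[OF cls_hom] .

lemma cls_mult:
  "p \<in> carrier (free_alg T) \<Longrightarrow> r \<in> carrier (free_alg T) \<Longrightarrow>
    cls T (p * r) = cls T p \<otimes>\<^bsub>UL T\<^esub> cls T r"
  using ring_hom_mult[OF cls_hom] by (simp add: free_alg_simps)

lemma cls_add:
  "p \<in> carrier (free_alg T) \<Longrightarrow> r \<in> carrier (free_alg T) \<Longrightarrow>
    cls T (p + r) = cls T p \<oplus>\<^bsub>UL T\<^esub> cls T r"
  using ring_hom_add[OF cls_hom] by (simp add: free_alg_simps)

lemma cls_one: "cls T 1 = \<one>\<^bsub>UL T\<^esub>"
  using ring_hom_one[OF cls_hom] by (simp add: free_alg_simps)

lemma cls_surj:
  assumes "a \<in> carrier (UL T)"
  obtains p where "p \<in> carrier (free_alg T)" "a = cls T p"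
  using assms unfolding UL_def FactRing_def A_RCOSETS_def' cls_def by auto

lemma cls_eqI:
  assumes "p - r \<in> relations T" "p \<in> carrier (free_alg T)" "r \<in> carrier (free_alg T)"
  shows "cls T p = cls T r"
proof -
  have "p - r \<in> rel_ideal T"
    using assms ring.genideal_self[OF ring_free_alg relations_in_free_alg]
    unfolding rel_ideal_def by blast
  then show ?thesis
    using ring.quotient_eq_iff_same_a_r_cos[OF ring_free_alg ideal_rel_ideal assms(2,3)]
    unfolding cls_def by (simp add: free_alg_minus[OF assms(2,3)])
qed

lemma scU_closed: "scU T c \<in> carrier (UL T)"
  by (simp add: scU_def cls_closed fscal_in_free_alg)

lemma eU_closed: "i \<in> affine_nodes T \<Longrightarrow> eU T s i \<in> carrier (UL T)"
  and kU_closed: "i \<in> affine_nodes T \<Longrightarrow> kU T i \<in> carrier (UL T)"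
  and kinvU_closed: "i \<in> affine_nodes T \<Longrightarrow> kinvU T i \<in> carrier (UL T)"
  by (simp_all add: eU_def kU_def kinvU_def cls_closed fgen_in_free_alg gens_affine)

lemma scU_one: "scU T 1 = \<one>\<^bsub>UL T\<^esub>"
  using cls_one by (simp add: scU_def fscal_def flip: zero_list_def)

lemma scU_zero: "scU T 0 = \<zero>\<^bsub>UL T\<^esub>"
proof -
  \<comment> \<open>An element equal to its own double is zero.\<close>
  have "cls T (0 + 0) = cls T 0 \<oplus>\<^bsub>UL T\<^esub> cls T 0"
    by (rule cls_add) (rule zero_in_free_alg)+
  then show ?thesis
    using cls_closed[OF zero_in_free_alg] by (simp add: scU_def fscal_def)
qed

text \<open>The empty word commutes with every word, and \<open>p\<close> is the sum of its
  monomials.\<close>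

lemma fscal_central: "fscal c * p = p * fscal c"
proof -
  have p: "p = (\<Sum>k\<in>Poly_Mapping.keys p. Poly_Mapping.single k (Poly_Mapping.lookup p k))"
    by (rule poly_mapping_eqI)
       (auto simp: lookup_sum lookup_single when_def sum.delta in_keys_iff)
  have "fscal c * Poly_Mapping.single k v = Poly_Mapping.single k v * fscal c" for k v
    by (simp add: fscal_def mult_single mult.commute flip: zero_list_def)
  then show ?thesis
    by (subst (1 2) p) (simp add: sum_distrib_left sum_distrib_right)
qed

lemma scU_central: "a \<in> carrier (UL T) \<Longrightarrow> scU T c \<otimes>\<^bsub>UL T\<^esub> a = a \<otimes>\<^bsub>UL T\<^esub> scU T c"
  by (elim cls_surj) (simp add: scU_def fscal_central fscal_in_free_alg flip: cls_mult)

lemma kU_kinvU: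
  assumes "i \<in> affine_nodes T"
  shows "kU T i \<otimes>\<^bsub>UL T\<^esub> kinvU T i = \<one>\<^bsub>UL T\<^esub>"
    and "kinvU T i \<otimes>\<^bsub>UL T\<^esub> kU T i = \<one>\<^bsub>UL T\<^esub>"
proof -
  have "fgen (K i) * fgen (Kinv i) - 1 \<in> relations T"
    and "fgen (Kinv i) * fgen (K i) - 1 \<in> relations T"
    using assms unfolding relations_def by blast+
  then have "cls T (fgen (K i) * fgen (Kinv i)) = cls T 1"
    and "cls T (fgen (Kinv i) * fgen (K i)) = cls T 1"
    using assms by (simp_all only: cls_eqI free_alg_closed gens_affine)
  then show "kU T i \<otimes>\<^bsub>UL T\<^esub> kinvU T i = \<one>\<^bsub>UL T\<^esub>"
    and "kinvU T i \<otimes>\<^bsub>UL T\<^esub> kU T i = \<one>\<^bsub>UL T\<^esub>"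
    using assms by (simp_all add: kU_def kinvU_def cls_mult cls_one free_alg_closed gens_affine)
qed

lemma kU_commute:
  assumes "i \<in> affine_nodes T" "j \<in> affine_nodes T"
  shows "kU T i \<otimes>\<^bsub>UL T\<^esub> kU T j = kU T j \<otimes>\<^bsub>UL T\<^esub> kU T i"
proof -
  have "fgen (K i) * fgen (K j) - fgen (K j) * fgen (K i) \<in> relations T"
    using assms unfolding relations_def by blast
  then have "cls T (fgen (K i) * fgen (K j)) = cls T (fgen (K j) * fgen (K i))"
    using assms by (simp only: cls_eqI free_alg_closed gens_affine)
  then show ?thesis
    using assms by (simp add: kU_def cls_mult free_alg_closed gens_affine)
qed

lemma kU_eU:
  assumes "i \<in> affine_nodes T" "j \<in> affine_nodes T"
  shows "kU T i \<otimes>\<^bsub>UL T\<^esub> eU T s j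
    = scU T (qi T i powi (sgn_of s * csig T i j)) \<otimes>\<^bsub>UL T\<^esub> eU T s j \<otimes>\<^bsub>UL T\<^esub> kU T i"
proof -
  have "fgen (K i) * fgen (E s j)
      - fscal (qi T i powi (sgn_of s * csig T i j)) * fgen (E s j) * fgen (K i) \<in> relations T"
    using assms unfolding relations_def by blast
  then have "cls T (fgen (K i) * fgen (E s j))
      = cls T (fscal (qi T i powi (sgn_of s * csig T i j)) * fgen (E s j) * fgen (K i))"
    using assms by (intro cls_eqI) (simp_all add: free_alg_closed gens_affine)
  then show ?thesis
    using assms unfolding kU_def eU_def scU_def
    by (simp add: cls_mult free_alg_closed gens_affine)
qed

text \<open>Taken as a set so that its closure under the ring operations carries commutation through
  the sums and products that build \<open>phiU\<close>.\<close>

definition commutant :: "twisted \<Rightarrow> falg set \<Rightarrow> falg set set" where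
  "commutant T z = {a \<in> carrier (UL T). a \<otimes>\<^bsub>UL T\<^esub> z = z \<otimes>\<^bsub>UL T\<^esub> a}"

context
  fixes T z assumes z: "z \<in> carrier (UL T)"
begin

lemma commutant_closed: "a \<in> commutant T z \<Longrightarrow> a \<in> carrier (UL T)"
  by (simp add: commutant_def)

text \<open>Exchanges the roles of the fixed element and the one assembled from generators.\<close>

lemma commutant_swap: "a \<in> commutant T z \<Longrightarrow> z \<in> commutant T a"
  using z by (simp add: commutant_def)

lemma zero_commutant: "\<zero>\<^bsub>UL T\<^esub> \<in> commutant T z"
  using z by (simp add: commutant_def)

lemma one_commutant: "\<one>\<^bsub>UL T\<^esub> \<in> commutant T z"
  using z by (simp add: commutant_def)

lemma scU_commutant: "scU T c \<in> commutant T z"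
  using z by (simp add: commutant_def scU_closed scU_central)

lemma add_commutant:
  "a \<in> commutant T z \<Longrightarrow> b \<in> commutant T z \<Longrightarrow> a \<oplus>\<^bsub>UL T\<^esub> b \<in> commutant T z"
  using z by (simp add: commutant_def UL.l_distr UL.r_distr)

lemma mult_commutant:
  assumes "a \<in> commutant T z" "b \<in> commutant T z"
  shows "a \<otimes>\<^bsub>UL T\<^esub> b \<in> commutant T z"
proof -
  have a: "a \<in> carrier (UL T)" "a \<otimes>\<^bsub>UL T\<^esub> z = z \<otimes>\<^bsub>UL T\<^esub> a"
    and b: "b \<in> carrier (UL T)" "b \<otimes>\<^bsub>UL T\<^esub> z = z \<otimes>\<^bsub>UL T\<^esub> b"
    using assms by (simp_all add: commutant_def)
  have "a \<otimes>\<^bsub>UL T\<^esub> b \<otimes>\<^bsub>UL T\<^esub> z = a \<otimes>\<^bsub>UL T\<^esub> z \<otimes>\<^bsub>UL T\<^esub> b"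
    using a(1) b z by (simp add: UL.m_assoc)
  also have "\<dots> = z \<otimes>\<^bsub>UL T\<^esub> (a \<otimes>\<^bsub>UL T\<^esub> b)"
    unfolding a(2) using a(1) b(1) z by (simp add: UL.m_assoc)
  finally show ?thesis using a b by (simp add: commutant_def)
qed

lemma smulU_commutant: "a \<in> commutant T z \<Longrightarrow> smulU T c a \<in> commutant T z"
  by (simp add: smulU_def mult_commutant scU_commutant)

lemma finsum_commutant:
  "(\<And>i. i \<in> A \<Longrightarrow> f i \<in> commutant T z) \<Longrightarrow> finsum (UL T) f A \<in> commutant T z"
proof (induction A rule: infinite_finite_induct)
  \<comment> \<open>By convention the sum over an infinite set is zero.\<close>
  case (infinite A)
  then show ?case by (simp add: finsum_def finprod_def zero_commutant)
next
  case empty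
  then show ?case by (simp add: zero_commutant)
next
  case (insert a A)
  then show ?case
    by (subst UL.finsum_insert) (auto intro!: add_commutant commutant_closed)
qed

text \<open>Insert a b = 1: b z = b z a b = b a z b = z b.\<close>

lemma inverse_commutant:
  assumes "a \<in> commutant T z" "b \<in> carrier (UL T)"
    "a \<otimes>\<^bsub>UL T\<^esub> b = \<one>\<^bsub>UL T\<^esub>" "b \<otimes>\<^bsub>UL T\<^esub> a = \<one>\<^bsub>UL T\<^esub>"
  shows "b \<in> commutant T z"
proof -
  have a: "a \<in> carrier (UL T)" "a \<otimes>\<^bsub>UL T\<^esub> z = z \<otimes>\<^bsub>UL T\<^esub> a"
    using assms by (simp_all add: commutant_def)
  have "b \<otimes>\<^bsub>UL T\<^esub> z = b \<otimes>\<^bsub>UL T\<^esub> (z \<otimes>\<^bsub>UL T\<^esub> a) \<otimes>\<^bsub>UL T\<^esub> b"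
    using a assms z by (simp add: UL.m_assoc)
  also have "\<dots> = b \<otimes>\<^bsub>UL T\<^esub> a \<otimes>\<^bsub>UL T\<^esub> (z \<otimes>\<^bsub>UL T\<^esub> b)"
    using a assms(2) z by (simp add: UL.m_assoc flip: a(2))
  also have "\<dots> = z \<otimes>\<^bsub>UL T\<^esub> b"
    using assms z by simp
  finally show ?thesis using assms by (simp add: commutant_def)
qed

lemma psU_power_commutant:
  assumes "\<And>l. f l \<in> commutant T z"
  shows "psU_power T f n m \<in> commutant T z"
  by (induction n arbitrary: m)
     (auto simp: one_commutant zero_commutant intro!: finsum_commutant mult_commutant assms)

text \<open>Every coefficient is zero or the product of \<open>kpm T s i\<close> with a polynomial
  in the \<open>h i r\<close>.\<close>

lemma phiU_commutant:
  assumes "kpm T s i \<in> commutant T z" "\<And>r. r \<noteq> 0 \<Longrightarrow> h i r \<in> commutant T z"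
  shows "phiU T h s i m \<in> commutant T z"
proof -
  \<comment> \<open>The irrelevant value \<open>h i 0\<close> never enters: the constant term of the
    exponent is set to zero, and all other indices are nonzero.\<close>
  have "sgn_of s * int l \<noteq> 0" if "l \<noteq> 0" for l
    using that by (cases s) auto
  then show ?thesis
    unfolding phiU_def psU_exp_def
    by (auto intro!: mult_commutant finsum_commutant smulU_commutant psU_power_commutant
        zero_commutant assms)
qed

end

section \<open>Commutation of the k and the \<phi>\<close>

lemma kU_commutant:
  assumes "i \<in> affine_nodes T" "j \<in> affine_nodes T"
  shows "kU T i \<in> commutant T (kU T j)" "kinvU T i \<in> commutant T (kU T j)"
proof -
  show "kU T i \<in> commutant T (kU T j)"
    using assms by (simp add: commutant_def kU_closed kU_commute)
  from inverse_commutant[OF kU_closed[OF assms(2)] this] show "kinvU T i \<in> commutant T (kU T j)"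
    using assms by (simp add: kinvU_closed kU_kinvU)
qed

lemma (in drinfeld_generators) phiU_commute_kU:
  assumes "i \<in> nodes (dyn T)" "j \<in> nodes (dyn T)"
  shows "phiU T h s i m \<in> commutant T (kU T (Some (orb T j)))"
proof -
  have a: "Some (orb T i) \<in> affine_nodes T" "Some (orb T j) \<in> affine_nodes T"
    using assms by (simp_all add: affine_nodes_def reps_def)
  then have "kpm T s i \<in> commutant T (kU T (Some (orb T j)))"
    by (cases s) (simp_all add: kpm_def kU_commutant)
  moreover have "h i r \<in> commutant T (kU T (Some (orb T j)))" if "r \<noteq> 0" for r
    using k_h[OF assms(2,1) that, of Plus] h_carrier[OF assms(1) that]
    by (simp add: commutant_def kpm_def)
  ultimately show ?thesis by (intro phiU_commutant) (simp_all add: kU_closed a)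
qed

text \<open>Two passes: the expression of \<phi>_j in \<open>k\<close> and \<open>h\<close> shows
  that it commutes with every \<open>h i r\<close>; the expression of \<phi>_i then shows that it
  commutes with \<phi>_j.\<close>

lemma (in drinfeld_generators) phiU_commute:
  assumes "i \<in> nodes (dyn T)" "j \<in> nodes (dyn T)"
  shows "phiU T h Plus i m \<in> commutant T (phiU T h Plus j n)"
proof -
  have "Some (orb T i) \<in> affine_nodes T"
    using assms by (simp add: affine_nodes_def reps_def)
  then have k: "kU T (Some (orb T i)) \<in> carrier (UL T)" by (rule kU_closed)
  have "Some (orb T j) \<in> affine_nodes T"
    using assms by (simp add: affine_nodes_def reps_def)
  then have kj: "kpm T Plus j \<in> carrier (UL T)" by (simp add: kpm_def kU_closed)
  have closed: "phiU T h Plus j n \<in> carrier (UL T)"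
    using phiU_commute_kU[OF assms(2,1)] by (simp add: commutant_def)
  have "kpm T Plus i \<in> commutant T (phiU T h Plus j n)"
    using commutant_swap[OF k phiU_commute_kU[OF assms(2,1)]] by (simp add: kpm_def)
  moreover have "h i r \<in> commutant T (phiU T h Plus j n)" if r: "r \<noteq> 0" for r
  proof (rule commutant_swap)
    show "h i r \<in> carrier (UL T)" using assms r by (simp add: h_carrier)
    then show "phiU T h Plus j n \<in> commutant T (h i r)"
      by (rule phiU_commutant)
         (use assms r kj in \<open>auto simp: commutant_def h_carrier h_h k_h\<close>)
  qed
  ultimately show ?thesis by (intro phiU_commutant closed)
qed

section \<open>Subalgebras and elements of definite weight\<close>

lemma scU_in_subalg: "scU T c \<in> subalg_gen T S"
  by (simp add: subalg_gen_def generate_ring.incl)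

lemma subalg_gen_mono:
  assumes "S \<subseteq> S'"
  shows "subalg_gen T S \<subseteq> subalg_gen T S'"
proof
  fix a assume "a \<in> subalg_gen T S"
  then have "a \<in> generate_ring (UL T) (range (scU T) \<union> S)" by (simp add: subalg_gen_def)
  then show "a \<in> subalg_gen T S'"
    unfolding subalg_gen_def
    by induction (use assms in \<open>auto intro: generate_ring.intros\<close>)
qed

lemma subalg_gen_in_carrier:
  assumes "S \<subseteq> carrier (UL T)"
  shows "subalg_gen T S \<subseteq> carrier (UL T)"
  unfolding subalg_gen_def
  by (rule UL.generate_ring_incl) (use assms scU_closed in auto)

lemma borel_in_carrier: "borel T \<subseteq> carrier (UL T)"
  unfolding borel_def
  by (rule subalg_gen_in_carrier) (auto simp: eU_closed kU_closed kinvU_closed)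

lemma torus_in_borel: "torus T \<subseteq> borel T"
  unfolding torus_def borel_def by (rule subalg_gen_mono) (auto simp: affine_nodes_def)

lemma kU_in_torus: "j \<in> reps T \<Longrightarrow> kU T (Some j) \<in> torus T"
  and kinvU_in_torus: "j \<in> reps T \<Longrightarrow> kinvU T (Some j) \<in> torus T"
  by (auto simp: torus_def subalg_gen_def intro!: generate_ring.incl)

lemma borel_generators:
  assumes "i \<in> affine_nodes T"
  shows "eU T Plus i \<in> borel T" "kU T i \<in> borel T" "kinvU T i \<in> borel T"
  using assms by (auto simp: borel_def subalg_gen_def intro!: generate_ring.incl)

lemma borel_ops:
  "a \<in> borel T \<Longrightarrow> b \<in> borel T \<Longrightarrow> a \<oplus>\<^bsub>UL T\<^esub> b \<in> borel T"
  "a \<in> borel T \<Longrightarrow> b \<in> borel T \<Longrightarrow> a \<otimes>\<^bsub>UL T\<^esub> b \<in> borel T"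
  "a \<in> borel T \<Longrightarrow> \<ominus>\<^bsub>UL T\<^esub> a \<in> borel T"
  unfolding borel_def subalg_gen_def by (fact generate_ring.intros)+

lemma torus_ops:
  "a \<in> torus T \<Longrightarrow> b \<in> torus T \<Longrightarrow> a \<oplus>\<^bsub>UL T\<^esub> b \<in> torus T"
  "a \<in> torus T \<Longrightarrow> b \<in> torus T \<Longrightarrow> a \<otimes>\<^bsub>UL T\<^esub> b \<in> torus T"
  unfolding torus_def subalg_gen_def by (fact generate_ring.intros)+

lemma scU_in_borel: "scU T c \<in> borel T" and scU_in_torus: "scU T c \<in> torus T"
  by (simp_all add: borel_def torus_def scU_in_subalg)

text \<open>Conjugation by k_j multiplies \<open>a\<close> by \<open>c j\<close>, written without
  inverses. Such elements send weight vectors to weight vectors or to zero.\<close>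

definition k_shift :: "twisted \<Rightarrow> (nat \<Rightarrow> complex) \<Rightarrow> falg set \<Rightarrow> bool" where
  "k_shift T c a \<longleftrightarrow> a \<in> borel T \<and> (\<forall>j\<in>reps T.
     kU T (Some j) \<otimes>\<^bsub>UL T\<^esub> a = scU T (c j) \<otimes>\<^bsub>UL T\<^esub> a \<otimes>\<^bsub>UL T\<^esub> kU T (Some j))"

lemma k_shift_commutant:
  assumes "a \<in> borel T" "\<And>j. j \<in> reps T \<Longrightarrow> a \<in> commutant T (kU T (Some j))"
  shows "k_shift T (\<lambda>_. 1) a"
proof -
  have "a \<in> carrier (UL T)" using assms borel_in_carrier by blast
  then show ?thesis using assms by (simp add: k_shift_def commutant_def scU_one)
qed

lemma k_shift_generators:
  assumes "i \<in> affine_nodes T" "g \<in> {eU T Plus i, kU T i, kinvU T i}"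
  shows "\<exists>c. k_shift T c g"
proof -
  have "k_shift T (\<lambda>j. qi T (Some j) powi (sgn_of Plus * csig T (Some j) i)) (eU T Plus i)"
    using assms(1) by (auto simp: k_shift_def borel_generators kU_eU affine_nodes_def)
  moreover have "k_shift T (\<lambda>_. 1) (kU T i)" "k_shift T (\<lambda>_. 1) (kinvU T i)"
    using assms(1)
    by (auto intro!: k_shift_commutant borel_generators kU_commutant simp: affine_nodes_simps)
  ultimately show ?thesis using assms(2) by blast
qed

text \<open>The commutant is a subalgebra and contains the inverses of its invertible elements, so
  the k_j alone decide.\<close>

lemma torus_commutant:
  assumes z: "z \<in> carrier (UL T)" and k: "\<And>j. j \<in> reps T \<Longrightarrow> kU T (Some j) \<in> commutant T z"
  shows "torus T \<subseteq> commutant T z"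
proof
  fix a assume "a \<in> torus T"
  then have "a \<in> generate_ring (UL T) (range (scU T) \<union> (\<Union>i\<in>reps T. {kU T (Some i), kinvU T (Some i)}))"
    by (simp add: torus_def subalg_gen_def)
  then show "a \<in> commutant T z"
  proof induction
    case one
    then show ?case using z by (rule one_commutant)
  next
    case (incl g)
    have "kinvU T (Some j) \<in> commutant T z" if j: "j \<in> reps T" for j
      using inverse_commutant[OF z k[OF j]] affine_nodes_simps(2)[OF j]
      by (simp add: kinvU_closed kU_kinvU)
    then show ?case using incl k scU_commutant[OF z] by blast
  next
    case (a_inv g)
    then show ?case using z by (simp add: commutant_def UL.l_minus UL.r_minus)
  qed (simp_all add: z add_commutant mult_commutant)
qed


section \<open>Weights of modules over the Borel subalgebra\<close>

locale borel_rep = complex_vector_space scale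
  for scale :: "complex \<Rightarrow> 'v::ab_group_add \<Rightarrow> 'v" +
  fixes T :: twisted and act :: "falg set \<Rightarrow> 'v \<Rightarrow> 'v" and V :: "'v set"
  assumes borel_module: "borel_module T scale act V"
begin

lemma subspace_V: "subspace V"
  and act_in: "a \<in> borel T \<Longrightarrow> v \<in> V \<Longrightarrow> act a v \<in> V"
  and act_add: "a \<in> borel T \<Longrightarrow> v \<in> V \<Longrightarrow> w \<in> V \<Longrightarrow> act a (v + w) = act a v + act a w"
  and act_plus: "a \<in> borel T \<Longrightarrow> b \<in> borel T \<Longrightarrow> v \<in> V \<Longrightarrow>
    act (a \<oplus>\<^bsub>UL T\<^esub> b) v = act a v + act b v"
  and act_mult: "a \<in> borel T \<Longrightarrow> b \<in> borel T \<Longrightarrow> v \<in> V \<Longrightarrow>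
    act (a \<otimes>\<^bsub>UL T\<^esub> b) v = act a (act b v)"
  and act_scU: "v \<in> V \<Longrightarrow> act (scU T c) v = scale c v"
  using borel_module unfolding borel_module_def by blast+

lemma act_one: "v \<in> V \<Longrightarrow> act \<one>\<^bsub>UL T\<^esub> v = v"
  using act_scU[of v 1] by (simp add: scU_one)

text \<open>Complex linearity follows from the module axioms: the elements \<open>scU T c\<close>
  are central and act as the scalars \<open>c\<close>.\<close>

lemma act_scale:
  assumes "a \<in> borel T" "v \<in> V"
  shows "act a (scale c v) = scale c (act a v)"
proof -
  have "act (a \<otimes>\<^bsub>UL T\<^esub> scU T c) v = act (scU T c \<otimes>\<^bsub>UL T\<^esub> a) v"
    using scU_central[OF subsetD[OF borel_in_carrier assms(1)], of c] by simp
  then show ?thesis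
    using assms by (simp add: act_mult scU_in_borel act_scU act_in)
qed

lemma act_0: "a \<in> borel T \<Longrightarrow> act a 0 = 0"
  using act_scale[of a 0 0] subspace_V by (simp add: subspace_0)

lemma act_uminus:
  assumes "a \<in> borel T" "v \<in> V"
  shows "act (\<ominus>\<^bsub>UL T\<^esub> a) v = - act a v"
proof -
  have "act (\<ominus>\<^bsub>UL T\<^esub> a \<oplus>\<^bsub>UL T\<^esub> a) v = act (\<ominus>\<^bsub>UL T\<^esub> a) v + act a v"
    using assms borel_ops by (intro act_plus)
  moreover have "\<ominus>\<^bsub>UL T\<^esub> a \<oplus>\<^bsub>UL T\<^esub> a = scU T 0"
    using UL.l_neg[OF subsetD[OF borel_in_carrier assms(1)]] by (simp add: scU_zero)
  ultimately show ?thesis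
    using assms by (simp add: act_scU add_eq_0_iff2)
qed

lemma linear_within_V: "a \<in> borel T \<Longrightarrow> linear_within V (act a)"
  by (auto simp: linear_within_def act_in act_add act_scale)

section \<open>Weight vectors and their characters\<close>

abbreviation wt :: "(falg set \<Rightarrow> complex) \<Rightarrow> 'v set" where
  "wt \<equiv> wt_space T scale act V"

lemma subspace_wt: "subspace (wt \<chi>)"
proof (rule subspaceI)
  have t: "a \<in> torus T \<Longrightarrow> a \<in> borel T" for a using torus_in_borel by blast
  show "0 \<in> wt \<chi>"
    using subspace_V by (simp add: wt_space_def subspace_0 act_0 t)
  show "v + w \<in> wt \<chi>" if "v \<in> wt \<chi>" "w \<in> wt \<chi>" for v w
    using that subspace_V
    by (simp add: wt_space_def subspace_add act_add t scale_right_distrib)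
  show "scale c v \<in> wt \<chi>" if "v \<in> wt \<chi>" for c v
    using that subspace_V
    by (simp add: wt_space_def subspace_scale act_scale t mult.commute)
qed

text \<open>The elements having \<open>w\<close> as an eigenvector are closed under the ring
  operations, so only the inverses of the k_j need an argument.\<close>

lemma torus_eigenvector:
  assumes w: "w \<in> V" "w \<noteq> 0" and k: "\<And>j. j \<in> reps T \<Longrightarrow> \<exists>c. act (kU T (Some j)) w = scale c w"
    and a: "a \<in> torus T"
  shows "\<exists>c. act a w = scale c w"
proof -
  have kinv: "\<exists>c. act (kinvU T (Some j)) w = scale c w" if j: "j \<in> reps T" for j
  proof -
    have jj: "Some j \<in> affine_nodes T" using j by (rule affine_nodes_simps)
    obtain c where c: "act (kU T (Some j)) w = scale c w" using k j by blast
    have "w = act (kinvU T (Some j) \<otimes>\<^bsub>UL T\<^esub> kU T (Some j)) w"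
      using w by (simp add: kU_kinvU jj act_one)
    also have "\<dots> = scale c (act (kinvU T (Some j)) w)"
      using w by (simp add: act_mult borel_generators jj c act_scale)
    finally have w_eq: "w = scale c (act (kinvU T (Some j)) w)" .
    \<comment> \<open>A zero eigenvalue of k_j would make w = k_j^(-1) k_j w vanish.\<close>
    then have "c \<noteq> 0" using w by auto
    then have "act (kinvU T (Some j)) w = scale (inverse c) w"
      by (subst w_eq) simp
    then show ?thesis by blast
  qed
  have "a \<in> generate_ring (UL T) (range (scU T) \<union> (\<Union>i\<in>reps T. {kU T (Some i), kinvU T (Some i)}))"
    using a by (simp add: torus_def subalg_gen_def)
  \<comment> \<open>Membership in the Borel subalgebra is carried along, as the action is known to
    be additive and multiplicative only there.\<close>
  then have "a \<in> borel T \<and> (\<exists>c. act a w = scale c w)"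
  proof induction
    case one
    then show ?case
      using w scU_in_borel[of T 1] by (auto simp: act_one scU_one intro!: exI[of _ 1])
  next
    case (incl g)
    then show ?case
      using w k kinv by (auto simp: act_scU scU_in_borel borel_generators affine_nodes_simps)
  next
    case (a_inv g)
    then show ?case
      using w by (auto simp: borel_ops act_uminus simp flip: scale_minus_left)
  next
    case (eng_add g g')
    then show ?case
      using w by (auto simp: borel_ops act_plus simp flip: scale_left_distrib)
  next
    case (eng_mult g g')
    then show ?case
      using w by (auto simp: borel_ops act_mult act_scale)
  qed
  then show ?thesis by blast
qed

text \<open>As \<open>w\<close> is nonzero, its eigenvalues are unique, and uniqueness turns the
  module laws into additivity and multiplicativity of \<chi>. Off the torus the values of \<chi> are
  arbitrary.\<close>

lemma weight_vector:
  assumes w: "w \<in> V" "w \<noteq> 0" and k: "\<And>j. j \<in> reps T \<Longrightarrow> \<exists>c. act (kU T (Some j)) w = scale c w"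
  shows "\<exists>\<chi>\<in>torus_chars T. w \<in> wt \<chi>"
proof -
  have t: "a \<in> torus T \<Longrightarrow> a \<in> borel T" for a using torus_in_borel by blast
  obtain \<chi> where \<chi>: "\<And>a. a \<in> torus T \<Longrightarrow> act a w = scale (\<chi> a) w"
    using torus_eigenvector[OF w k] by metis
  have unique: "\<chi> a = c" if "a \<in> torus T" "act a w = scale c w" for a c
    using \<chi>[OF that(1)] that(2) w by simp
  have "\<chi> (scU T c) = c" for c
    using w by (intro unique scU_in_torus act_scU)
  moreover have "\<chi> (a \<oplus>\<^bsub>UL T\<^esub> b) = \<chi> a + \<chi> b" if "a \<in> torus T" "b \<in> torus T" for a b
    using that w by (intro unique torus_ops) (simp_all add: act_plus t \<chi> scale_left_distrib)
  moreover have "\<chi> (a \<otimes>\<^bsub>UL T\<^esub> b) = \<chi> a * \<chi> b" if "a \<in> torus T" "b \<in> torus T" for a b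
    using that w by (intro unique torus_ops) (simp_all add: act_mult t \<chi> act_scale)
  ultimately have "\<chi> \<in> torus_chars T" by (simp add: torus_chars_def)
  moreover have "w \<in> wt \<chi>" using w \<chi> by (simp add: wt_space_def)
  ultimately show ?thesis by blast
qed

text \<open>Moving k_j past \<open>a\<close> multiplies the eigenvalue by \<open>c j\<close>. A zero
  image is excluded, as it would not determine eigenvalues.\<close>

lemma k_shift_weight:
  assumes w: "w \<in> wt \<chi>" and a: "k_shift T c a" and nz: "act a w \<noteq> 0"
  shows "\<exists>\<chi>'\<in>torus_chars T. act a w \<in> wt \<chi>' \<and> (\<forall>j\<in>reps T. \<chi>' (kU T (Some j)) = c j * \<chi> (kU T (Some j)))"
proof -
  have ab: "a \<in> borel T" and wV: "w \<in> V"
    using a w by (auto simp: k_shift_def wt_space_def)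
  have k: "act (kU T (Some j)) (act a w) = scale (c j * \<chi> (kU T (Some j))) (act a w)"
    if j: "j \<in> reps T" for j
  proof -
    have kb: "kU T (Some j) \<in> borel T" using kU_in_torus[OF j] torus_in_borel by blast
    have kw: "act (kU T (Some j)) w = scale (\<chi> (kU T (Some j))) w"
      using w kU_in_torus[OF j] by (simp add: wt_space_def)
    have "act (kU T (Some j) \<otimes>\<^bsub>UL T\<^esub> a) w
        = act (scU T (c j) \<otimes>\<^bsub>UL T\<^esub> a \<otimes>\<^bsub>UL T\<^esub> kU T (Some j)) w"
      using a j by (simp add: k_shift_def)
    then show ?thesis
      using kb ab wV
      by (simp add: act_mult scU_in_borel borel_ops act_in act_scU kw act_scale
          subspace_scale[OF subspace_V])
  qed
  obtain \<chi>' where \<chi>': "\<chi>' \<in> torus_chars T" "act a w \<in> wt \<chi>'"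
    using weight_vector[OF act_in[OF ab wV] nz] k by blast
  have "\<chi>' (kU T (Some j)) = c j * \<chi> (kU T (Some j))" if j: "j \<in> reps T" for j
  proof -
    have "scale (\<chi>' (kU T (Some j))) (act a w) = scale (c j * \<chi> (kU T (Some j))) (act a w)"
      using \<chi>'(2) k[OF j] kU_in_torus[OF j] by (simp add: wt_space_def)
    then show ?thesis using nz by (simp only: scale_cancel_right) blast
  qed
  then show ?thesis using \<chi>' by blast
qed

text \<open>Here the character stays the same; \<open>k_shift_weight\<close> would only give some
  character with prescribed values at the k_j.\<close>

lemma commutant_weight:
  assumes w: "w \<in> wt \<chi>" and a: "a \<in> borel T" and comm: "\<And>b. b \<in> torus T \<Longrightarrow> a \<in> commutant T b"
  shows "act a w \<in> wt \<chi>"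
proof -
  have "act b (act a w) = scale (\<chi> b) (act a w)" if b: "b \<in> torus T" for b
  proof -
    have bb: "b \<in> borel T" using b torus_in_borel by blast
    have "act (b \<otimes>\<^bsub>UL T\<^esub> a) w = act (a \<otimes>\<^bsub>UL T\<^esub> b) w"
      using comm[OF b] by (simp add: commutant_def)
    then show ?thesis
      using w a b bb by (simp add: wt_space_def act_mult act_scale)
  qed
  then show ?thesis using w a by (simp add: wt_space_def act_in)
qed

section \<open>Cyclic submodules\<close>

lemma borel_module_cyclic:
  assumes v: "v \<in> V"
  shows "borel_module T scale act ((\<lambda>a. act a v) ` borel T)"
proof -
  let ?W = "(\<lambda>a. act a v) ` borel T"
  have "subspace ?W"
  proof (rule subspaceI)
    have "act (scU T 0) v \<in> ?W" by (intro imageI scU_in_borel)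
    then show "0 \<in> ?W" using v by (simp add: act_scU)
    show "x + y \<in> ?W" if "x \<in> ?W" "y \<in> ?W" for x y
      using that v by (auto simp: borel_ops simp flip: act_plus)
    show "scale c x \<in> ?W" if "x \<in> ?W" for c x
      using that v by (auto simp: borel_ops act_in scU_in_borel simp flip: act_mult act_scU)
  qed
  moreover have sub: "?W \<subseteq> V" using v by (auto simp: act_in)
  moreover have "act b x \<in> ?W" if "b \<in> borel T" "x \<in> ?W" for b x
    using that v by (auto simp: borel_ops simp flip: act_mult)
  ultimately show ?thesis
    unfolding borel_module_def
    by (intro conjI ballI allI) (auto intro: act_add act_plus act_mult act_scU simp: subset_iff)
qed

text \<open>The main point is that the submodule is spanned by its weight vectors. Their span
  contains \<open>v\<close> and is stable under the generators of the Borel subalgebra, each of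
  which has a definite weight, so it is the whole submodule. The finiteness conditions are inherited
  from \<open>V\<close>.\<close>

lemma cyclic_in_category_O:
  assumes O: "in_category_O T scale act V" and \<chi>: "\<chi> \<in> torus_chars T" and v: "v \<in> wt \<chi>"
  shows "in_category_O T scale act ((\<lambda>a. act a v) ` borel T)"
proof -
  let ?W = "(\<lambda>a. act a v) ` borel T"
  have vV: "v \<in> V" using v by (simp add: wt_space_def)
  have W_V: "?W \<subseteq> V" using vV by (auto simp: act_in)
  have bW: "borel_module T scale act ?W" by (rule borel_module_cyclic[OF vV])
  interpret W: borel_rep scale T act ?W
    by unfold_locales (rule bW)
  let ?S = "\<Union>\<chi>\<in>torus_chars T. W.wt \<chi>"
  have wt_W: "W.wt \<mu> = wt \<mu> \<inter> ?W" for \<mu>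
    using W_V by (auto simp: wt_space_def)
  have S_W: "?S \<subseteq> ?W" by (auto simp: wt_space_def)
  have S_V: "span ?S \<subseteq> V" using S_W W_V subspace_V by (meson order_trans span_minimal)
  \<comment> \<open>Stability passes to sums, products and negatives, so only the generators need an
    argument.\<close>
  have stable: "b \<in> borel T \<and> (\<forall>u\<in>span ?S. act b u \<in> span ?S)"
    if "b \<in> generate_ring (UL T) (range (scU T) \<union> (\<Union>i\<in>affine_nodes T. {eU T Plus i, kU T i, kinvU T i}))"
    for b
    using that
  proof induction
    case one
    then show ?case
      using S_V scU_in_borel[of T 1] by (auto simp: act_one scU_one subset_iff)
  next
    case (incl g)
    then consider c where "g = scU T c"
      | i where "i \<in> affine_nodes T" "g \<in> {eU T Plus i, kU T i, kinvU T i}" by blast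
    then show ?case
    proof cases
      case 1
      then show ?thesis using S_V by (auto simp: act_scU scU_in_borel span_scale subset_iff)
    next
      case 2
      then obtain c where c: "k_shift T c g" using k_shift_generators by blast
      then have g: "g \<in> borel T" by (simp add: k_shift_def)
      have gen: "act g u \<in> span ?S" if u: "u \<in> ?S" for u
      proof (cases "act g u = 0")
        case False
        obtain \<mu> where \<mu>: "\<mu> \<in> torus_chars T" "u \<in> W.wt \<mu>" using u by blast
        have "\<exists>\<mu>'\<in>torus_chars T. act g u \<in> W.wt \<mu>'"
          using W.k_shift_weight[OF \<mu>(2) c False] by blast
        then show ?thesis by (blast intro: span_base)
      qed (simp add: span_zero)
      \<comment> \<open>The vectors that \<open>g\<close> sends into the span form a subspace, so
        weight vectors suffice.\<close>
      have "subspace {u \<in> V. act g u \<in> span ?S}"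
        using subspace_V g
        by (intro subspaceI)
           (auto simp: subspace_0 act_0 span_zero subspace_add act_add span_add subspace_scale
             act_scale span_scale)
      then have "span ?S \<subseteq> {u \<in> V. act g u \<in> span ?S}"
        using gen S_W W_V by (intro span_minimal) blast
      then show ?thesis using g by blast
    qed
  next
    case (a_inv g)
    then show ?case
      using S_V by (auto simp: borel_ops act_uminus span_neg subset_iff)
  next
    case (eng_add g g')
    then show ?case
      using S_V by (auto simp: borel_ops act_plus span_add subset_iff)
  next
    case (eng_mult g g')
    then show ?case
      using S_V by (auto simp: borel_ops act_mult subset_iff)
  qed
  have "act \<one>\<^bsub>UL T\<^esub> v \<in> ?W"
    using scU_in_borel[of T 1] by (intro imageI) (simp add: scU_one)
  then have "v \<in> ?W" using vV by (simp add: act_one)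
  then have "v \<in> ?S" using v \<chi> wt_W by blast
  then have "v \<in> span ?S" by (rule span_base)
  moreover have "act b u \<in> span ?S" if "b \<in> borel T" "u \<in> span ?S" for b u
    using stable[of b] that by (simp add: borel_def subalg_gen_def)
  ultimately have "?W \<subseteq> span ?S" by (simp add: image_subset_iff)
  then have spanW: "span ?S = ?W"
    using S_W W.subspace_V by (simp add: antisym span_minimal)
  \<comment> \<open>A weight space of the submodule is a subspace of the corresponding one of
    \<open>V\<close>.\<close>
  have fin: "\<exists>B. finite B \<and> span B = W.wt \<mu>" if \<mu>: "\<mu> \<in> torus_chars T" for \<mu>
  proof -
    obtain B where B: "finite B" "span B = wt \<mu>"
      using O \<mu> unfolding in_category_O_def by blast
    show ?thesis
    proof (cases "W.wt \<mu> = wt \<mu>")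
      case True
      then show ?thesis using B by auto
    next
      case False
      then show ?thesis
        using proper_subspace_card[OF B W.subspace_wt] wt_W by blast
    qed
  qed
  obtain S where S: "finite S" "S \<subseteq> torus_chars T"
    "{\<mu> \<in> torus_chars T. wt \<mu> \<noteq> {0}} \<subseteq> (\<Union>\<chi>\<in>S. cone T \<chi>)"
    using O unfolding in_category_O_def by blast
  have "{\<mu> \<in> torus_chars T. W.wt \<mu> \<noteq> {0}} \<subseteq> {\<mu> \<in> torus_chars T. wt \<mu> \<noteq> {0}}"
    using wt_W W.subspace_wt subspace_0 by blast
  then have "{\<mu> \<in> torus_chars T. W.wt \<mu> \<noteq> {0}} \<subseteq> (\<Union>\<chi>\<in>S. cone T \<chi>)"
    using S by blast
  then show ?thesis
    unfolding in_category_O_def using bW spanW fin S by blast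
qed

end


section \<open>Highest weights\<close>

text \<open>The product runs over all nodes, not over orbits, so that weights \<open>c\<close> found
  for the full Cartan matrix can be used as exponents.\<close>

definition char_height :: "twisted \<Rightarrow> (nat \<Rightarrow> nat) \<Rightarrow> (falg set \<Rightarrow> complex) \<Rightarrow> complex" where
  "char_height T c \<chi> = (\<Prod>j\<in>nodes (dyn T). \<chi> (kU T (Some (orb T j))) ^ c j)"

lemma torus_char_kU_nonzero:
  assumes "\<chi> \<in> torus_chars T" "j \<in> reps T"
  shows "\<chi> (kU T (Some j)) \<noteq> 0"
proof -
  have "\<chi> (kU T (Some j) \<otimes>\<^bsub>UL T\<^esub> kinvU T (Some j)) = \<chi> (kU T (Some j)) * \<chi> (kinvU T (Some j))"
    using assms kU_in_torus[OF assms(2)] kinvU_in_torus[OF assms(2)]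
    unfolding torus_chars_def by blast
  moreover have "\<chi> (kU T (Some j) \<otimes>\<^bsub>UL T\<^esub> kinvU T (Some j)) = 1"
    using assms unfolding torus_chars_def
    by (simp add: kU_kinvU affine_nodes_simps flip: scU_one)
  ultimately show ?thesis by auto
qed

text \<open>The shift does not depend on \<open>r\<close>: it is the simple root of the orbit of
  \<open>i\<close>.\<close>

lemma (in drinfeld_generators) k_shift_x:
  assumes "twisted_data T" "i \<in> nodes (dyn T)"
  shows "k_shift T (\<lambda>j. qpar T powi csum T j i) (x Plus i (int r))"
proof -
  interpret twisted_data T by fact
  have "kU T (Some j) \<otimes>\<^bsub>UL T\<^esub> x Plus i (int r)
      = scU T (qpar T powi csum T j i) \<otimes>\<^bsub>UL T\<^esub> x Plus i (int r) \<otimes>\<^bsub>UL T\<^esub> kU T (Some j)"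
    if j: "j \<in> reps T" for j
  proof -
    have "j \<in> nodes (dyn T)" using j reps_subset by blast
    then show ?thesis
      using k_x[of j i Plus "int r"] assms(2) x_carrier[OF assms(2)]
      by (simp add: kpm_def orb_reps[OF j] smulU_def UL.m_assoc scU_closed kU_closed
          affine_nodes_simps j)
  qed
  then show ?thesis using assms x_borel by (simp add: k_shift_def)
qed

section \<open>Heights of characters\<close>

context twisted_data begin

context
  fixes c :: "nat \<Rightarrow> nat"
  assumes c: "\<And>i. i \<in> nodes (dyn T) \<Longrightarrow>
    (\<Sum>j\<in>nodes (dyn T). csum T i j * int (c j)) = 4 * int (aut_order T)"
begin

lemma char_height_nonzero: "\<chi> \<in> torus_chars T \<Longrightarrow> char_height T c \<chi> \<noteq> 0"
  by (simp add: char_height_def finite_nodes torus_char_kU_nonzero orb_in_reps)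

text \<open>The exponents add up to the row sum fixed by \<open>c\<close>, which is the same for
  every \<open>i\<close>. So all simple roots raise the height by one common factor.\<close>

lemma char_height_root:
  assumes i: "i \<in> nodes (dyn T)"
  shows "(\<Prod>j\<in>nodes (dyn T). (qpar T powi csum T i (orb T j)) ^ c j) = qpar T ^ (4 * aut_order T)"
proof -
  have "(\<Prod>j\<in>nodes (dyn T). (qpar T powi csum T i (orb T j)) ^ c j)
      = qpar T powi int (4 * aut_order T)"
    by (simp add: csum_orb prod_power_int[OF q_nonzero] c[OF i])
  then show ?thesis by (simp only: power_int_of_nat)
qed

text \<open>All simple roots contribute the same factor, so only their total number \<open>N\<close>
  in \<chi> - \<mu> enters.\<close>

lemma char_height_cone:
  assumes "\<mu> \<in> cone T \<chi>"
  shows "\<exists>N. char_height T c \<chi> = char_height T c \<mu> * (qpar T ^ (4 * aut_order T)) ^ N"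
proof -
  obtain n where n: "\<And>j. j \<in> reps T \<Longrightarrow> \<chi> (kU T (Some j)) = \<mu> (kU T (Some j))
       * (\<Prod>i\<in>reps T. (qi T (Some i) powi csig T (Some i) (Some j)) ^ n i)"
    using assms unfolding cone_def wt_le_def by auto
  have reps: "i \<in> nodes (dyn T)" if "i \<in> reps T" for i
    using that reps_subset by blast
  let ?f = "\<lambda>i j. qpar T powi csum T i (orb T j)"
  have k: "\<chi> (kU T (Some (orb T j)))
      = \<mu> (kU T (Some (orb T j))) * (\<Prod>i\<in>reps T. ?f i j ^ n i)"
    if "j \<in> nodes (dyn T)" for j
    using n[OF orb_in_reps[OF that]] reps orb_in_reps[OF that]
    by (simp add: qi_powi_csig)
  have "char_height T c \<chi> = char_height T c \<mu> * (\<Prod>j\<in>nodes (dyn T). (\<Prod>i\<in>reps T. ?f i j ^ n i) ^ c j)"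
    by (simp add: char_height_def k power_mult_distrib prod.distrib)
  also have "(\<Prod>j\<in>nodes (dyn T). (\<Prod>i\<in>reps T. ?f i j ^ n i) ^ c j)
      = (\<Prod>j\<in>nodes (dyn T). \<Prod>i\<in>reps T. (?f i j ^ c j) ^ n i)"
    by (simp add: prod_power_distrib power_mult[symmetric] mult.commute)
  also have "\<dots> = (\<Prod>i\<in>reps T. (\<Prod>j\<in>nodes (dyn T). ?f i j ^ c j) ^ n i)"
    by (subst prod.swap) (simp add: prod_power_distrib)
  also have "\<dots> = (\<Prod>i\<in>reps T. (qpar T ^ (4 * aut_order T)) ^ n i)"
    using char_height_root reps by (intro prod.cong refl) simp
  also have "\<dots> = (qpar T ^ (4 * aut_order T)) ^ (\<Sum>i\<in>reps T. n i)"
    by (simp add: power_sum)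
  finally show ?thesis by blast
qed

text \<open>Unequal exponents would make q a root of unity.\<close>

lemma qpar_power_inject:
  assumes "(qpar T ^ (4 * aut_order T)) ^ a = (qpar T ^ (4 * aut_order T)) ^ b"
  shows "a = b"
proof -
  have pos: "aut_order T > 0" using order_cases by auto
  have le: "m \<le> l"
    if "(qpar T ^ (4 * aut_order T)) ^ l = (qpar T ^ (4 * aut_order T)) ^ m" for l m
  proof (rule ccontr)
    assume "\<not> m \<le> l"
    then obtain d where d: "m = l + d" "d > 0" by (metis less_imp_add_positive not_le)
    then have "qpar T ^ (4 * aut_order T * d) = 1"
      using that q_nonzero by (simp add: power_add power_mult)
    then show False using q_not_root_of_unity[of "4 * aut_order T * d"] d pos by simp
  qed
  show ?thesis using le[of a b] le[of b a] assms by simp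
qed

text \<open>Complex heights carry no suitable order, so they are compared through the exponent of
  q^(4M) relative to one fixed weight. The cones bound this exponent, and a weight that attains the
  maximum has the required property.\<close>

lemma highest_weight_exists:
  assumes nz: "V \<noteq> {0}" and O: "in_category_O T scale act V" and rep: "borel_rep scale T act V"
  obtains \<chi> where "\<chi> \<in> torus_chars T" "wt_space T scale act V \<chi> \<noteq> {0}"
    "\<And>\<mu>. \<mu> \<in> torus_chars T \<Longrightarrow> char_height T c \<mu> = char_height T c \<chi> * qpar T ^ (4 * aut_order T) \<Longrightarrow>
      wt_space T scale act V \<mu> = {0}"
proof -
  interpret borel_rep scale T act V by (rule rep)
  let ?p = "qpar T ^ (4 * aut_order T)"
  have V: "span (\<Union>\<chi>\<in>torus_chars T. wt \<chi>) = V" using O unfolding in_category_O_def by blast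
  have "\<exists>\<chi>\<in>torus_chars T. wt \<chi> \<noteq> {0}"
  proof (rule ccontr)
    assume "\<not> ?thesis"
    then have "(\<Union>\<chi>\<in>torus_chars T. wt \<chi>) \<subseteq> {0}" by blast
    then have "span (\<Union>\<chi>\<in>torus_chars T. wt \<chi>) \<subseteq> {0}"
      by (simp add: span_minimal subspace_single_0)
    then show False using V nz subspace_V subspace_0 by blast
  qed
  then obtain \<chi>\<^sub>0 where \<chi>\<^sub>0: "\<chi>\<^sub>0 \<in> torus_chars T" "wt \<chi>\<^sub>0 \<noteq> {0}" by blast
  obtain S where S: "finite S"
    "{\<mu> \<in> torus_chars T. wt \<mu> \<noteq> {0}} \<subseteq> (\<Union>\<chi>\<in>S. cone T \<chi>)"
    using O unfolding in_category_O_def by blast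
  define A where "A = {t. \<exists>\<mu>\<in>torus_chars T. wt \<mu> \<noteq> {0} \<and> char_height T c \<mu> = char_height T c \<chi>\<^sub>0 * ?p ^ t}"
  \<comment> \<open>As q has infinite order, an apex s determines t + N, which bounds t.\<close>
  have "finite {t. \<exists>N. char_height T c s = char_height T c \<chi>\<^sub>0 * ?p ^ (t + N)}" (is "finite ?B") for s
  proof (cases "?B = {}")
    case False
    then obtain t N where t: "char_height T c s = char_height T c \<chi>\<^sub>0 * ?p ^ (t + N)" by blast
    have "t' \<le> t + N" if t': "char_height T c s = char_height T c \<chi>\<^sub>0 * ?p ^ (t' + N')" for t' N'
    proof -
      have "?p ^ (t' + N') = ?p ^ (t + N)" using t t' char_height_nonzero[OF \<chi>\<^sub>0(1)] by simp
      then show ?thesis using qpar_power_inject by fastforce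
    qed
    then have "?B \<subseteq> {..t + N}" by auto
    then show ?thesis using finite_subset by blast
  qed simp
  moreover have "A \<subseteq> (\<Union>s\<in>S. {t. \<exists>N. char_height T c s = char_height T c \<chi>\<^sub>0 * ?p ^ (t + N)})"
  proof
    fix t assume "t \<in> A"
    then obtain \<mu> where \<mu>: "\<mu> \<in> torus_chars T" "wt \<mu> \<noteq> {0}" "char_height T c \<mu> = char_height T c \<chi>\<^sub>0 * ?p ^ t"
      unfolding A_def by blast
    then obtain s where s: "s \<in> S" "\<mu> \<in> cone T s" using S by blast
    obtain N where "char_height T c s = char_height T c \<mu> * ?p ^ N" using char_height_cone[OF s(2)] by blast
    then have "char_height T c s = char_height T c \<chi>\<^sub>0 * ?p ^ (t + N)" using \<mu>(3) by (simp add: power_add)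
    then show "t \<in> (\<Union>s\<in>S. {t. \<exists>N. char_height T c s = char_height T c \<chi>\<^sub>0 * ?p ^ (t + N)})" using s by blast
  qed
  ultimately have finA: "finite A" using S(1) by (meson finite_UN_I finite_subset)
  have "0 \<in> A" unfolding A_def using \<chi>\<^sub>0 by auto
  then have "Max A \<in> A" using finA by (intro Max_in) auto
  then obtain \<chi> where \<chi>: "\<chi> \<in> torus_chars T" "wt \<chi> \<noteq> {0}" "char_height T c \<chi> = char_height T c \<chi>\<^sub>0 * ?p ^ Max A"
    unfolding A_def by blast
  show ?thesis
  proof (rule that[OF \<chi>(1,2)])
    fix \<mu> assume \<mu>: "\<mu> \<in> torus_chars T" "char_height T c \<mu> = char_height T c \<chi> * ?p"
    show "wt \<mu> = {0}"
    proof (rule ccontr)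
      assume "wt \<mu> \<noteq> {0}"
      moreover have "char_height T c \<mu> = char_height T c \<chi>\<^sub>0 * ?p ^ Suc (Max A)" using \<mu>(2) \<chi>(3) by simp
      ultimately have "Suc (Max A) \<in> A" using \<mu>(1) unfolding A_def by blast
      then show False using Max_ge[OF finA] by fastforce
    qed
  qed
qed

end

end

theorem theorem4p10:
  fixes T :: twisted
    and x :: "pm \<Rightarrow> nat \<Rightarrow> int \<Rightarrow> falg set"
    and h :: "nat \<Rightarrow> int \<Rightarrow> falg set"
    and scale :: "complex \<Rightarrow> 'v::ab_group_add \<Rightarrow> 'v"
    and act :: "falg set \<Rightarrow> 'v \<Rightarrow> 'v"
    and V :: "'v set"
  assumes "twisted_data T"
    and "drinfeld_generators T x h"
    and "vector_space scale"
    and "simple_in_O T scale act V"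
  shows "l_highest_weight T x h scale act V"
proof -
  interpret twisted_data T by fact
  interpret drinfeld_generators T x h by fact
  have O: "in_category_O T scale act V" and nz: "V \<noteq> {0}"
    using assms(4) unfolding simple_in_O_def by blast+
  then have module: "borel_module T scale act V" unfolding in_category_O_def by blast
  interpret borel_rep scale T act V
    by (intro borel_rep.intro complex_vector_space.intro borel_rep_axioms.intro assms(3) module)
  obtain c :: "nat \<Rightarrow> nat" where c: "\<And>i. i \<in> nodes (dyn T) \<Longrightarrow>
      (\<Sum>j\<in>nodes (dyn T). csum T i j * int (c j)) = 4 * int (aut_order T)"
    using csum_height_weights by blast
  obtain \<chi> where \<chi>: "\<chi> \<in> torus_chars T" "wt \<chi> \<noteq> {0}"
    and top: "\<And>\<mu>. \<mu> \<in> torus_chars T \<Longrightarrow> char_height T c \<mu> = char_height T c \<chi> * qpar T ^ (4 * aut_order T) \<Longrightarrow>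
      wt \<mu> = {0}"
    using highest_weight_exists[OF c nz O borel_rep_axioms] by blast
  \<comment> \<open>A nonzero image would have weight \<chi> + \<alpha>_i, one step above \<chi> in
    height, where no weight exists.\<close>
  have kill: "act (x Plus i (int r)) w = 0" if i: "i \<in> nodes (dyn T)" and w: "w \<in> wt \<chi>" for i r w
  proof (rule ccontr)
    assume "act (x Plus i (int r)) w \<noteq> 0"
    then obtain \<mu> where \<mu>: "\<mu> \<in> torus_chars T" "act (x Plus i (int r)) w \<in> wt \<mu>"
      and k: "\<And>j. j \<in> reps T \<Longrightarrow> \<mu> (kU T (Some j)) = qpar T powi csum T j i * \<chi> (kU T (Some j))"
      and nonzero: "act (x Plus i (int r)) w \<noteq> 0"
      using k_shift_weight[OF w k_shift_x[OF assms(1) i]] by blast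
    \<comment> \<open>The shift is given by \<open>csum T j i\<close>, the height of a root by a row
      sum of \<open>csum T i j\<close>; symmetry matches the two.\<close>
    have "char_height T c \<mu> = char_height T c \<chi> * (\<Prod>j\<in>nodes (dyn T). (qpar T powi csum T i (orb T j)) ^ c j)"
      unfolding char_height_def prod.distrib[symmetric]
    proof (rule prod.cong)
      fix j assume "j \<in> nodes (dyn T)"
      then have j: "orb T j \<in> reps T" "orb T j \<in> nodes (dyn T)"
        using reps_subset orb_in_reps by auto
      show "\<mu> (kU T (Some (orb T j))) ^ c j
          = \<chi> (kU T (Some (orb T j))) ^ c j * (qpar T powi csum T i (orb T j)) ^ c j"
        unfolding k[OF j(1)] csum_sym[OF i j(2)] by (simp add: power_mult_distrib mult.commute)
    qed simp
    then have "wt \<mu> = {0}" using top \<mu>(1) char_height_root[OF c i] by simp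
    then show False using \<mu>(2) nonzero by blast
  qed
  \<comment> \<open>All i and r at once: an infinite family of operators on a finite-dimensional
    space.\<close>
  define F where "F = {act (phiU T h Plus i (int r)) | i r. i \<in> nodes (dyn T)}"
  obtain B where B: "finite B" "span B = wt \<chi>"
    using O \<chi>(1) unfolding in_category_O_def by blast
  have wt_V: "wt \<chi> \<subseteq> V" by (auto simp: wt_space_def)
  have pb: "phiU T h Plus i (int r) \<in> borel T" if "i \<in> nodes (dyn T)" for i r
    using phi_borel[OF that] by simp
  have "\<exists>v\<in>wt \<chi>. v \<noteq> 0 \<and> (\<forall>f\<in>F. \<exists>a. f v = scale a v)"
  proof (rule common_eigenvector[OF B \<chi>(2)])
    fix f assume "f \<in> F"
    then obtain i r where i: "i \<in> nodes (dyn T)" and f: "f = act (phiU T h Plus i (int r))"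
      unfolding F_def by blast
    let ?a = "phiU T h Plus i (int r)"
    \<comment> \<open>Commuting with the torus, each \<phi> preserves the weight space of
      \<chi>.\<close>
    have "torus T \<subseteq> commutant T ?a"
    proof (rule torus_commutant)
      show ac: "?a \<in> carrier (UL T)" using pb[OF i] borel_in_carrier by blast
      show "kU T (Some j) \<in> commutant T ?a" if j: "j \<in> reps T" for j
        using phiU_commute_kU[OF i, of j Plus "int r"] j reps_subset orb_reps[OF j]
          commutant_swap kU_closed affine_nodes_simps(2) by (metis subsetD)
    qed
    then have "act ?a w \<in> wt \<chi>" if "w \<in> wt \<chi>" for w
      using commutant_weight[OF that pb[OF i]] borel_in_carrier pb[OF i] commutant_swap
      by (metis subsetD)
    then show "linear_within (wt \<chi>) f"
      using linear_within_V[OF pb[OF i, of r]] wt_V unfolding f linear_within_def by blast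
  next
    fix f g w assume "f \<in> F" "g \<in> F" and w: "w \<in> wt \<chi>"
    then obtain i r j s where i: "i \<in> nodes (dyn T)" and f: "f = act (phiU T h Plus i (int r))"
      and j: "j \<in> nodes (dyn T)" and g: "g = act (phiU T h Plus j (int s))"
      unfolding F_def by blast
    have "w \<in> V" using w wt_V by blast
    then show "f (g w) = g (f w)"
      using phiU_commute[OF i j, of "int r" "int s"]
      by (simp add: f g pb i j commutant_def flip: act_mult)
  qed
  then obtain v where v: "v \<in> wt \<chi>" "v \<noteq> 0" and eig: "\<And>f. f \<in> F \<Longrightarrow> \<exists>a. f v = scale a v"
    by blast
  have vV: "v \<in> V" using v wt_V by blast
  have "\<exists>a. act (phiU T h Plus i (int r)) v = scale a v" if "i \<in> nodes (dyn T)" for i r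
    using eig that unfolding F_def by blast
  then obtain a where a: "\<And>i r. i \<in> nodes (dyn T) \<Longrightarrow>
      act (phiU T h Plus i (int r)) v = scale (a i r) v"
    by metis
  let ?W = "(\<lambda>a. act a v) ` borel T"
  have "?W \<subseteq> V" using vV by (auto simp: act_in)
  moreover have "in_category_O T scale act ?W"
    by (rule cyclic_in_category_O[OF O \<chi>(1) v(1)])
  ultimately have "?W = {0} \<or> ?W = V"
    using assms(4) unfolding simple_in_O_def by blast
  \<comment> \<open>The identity puts \<open>v\<close> into the submodule, which is therefore
    nonzero.\<close>
  moreover have "act \<one>\<^bsub>UL T\<^esub> v \<in> ?W"
    using scU_in_borel[of T 1] by (intro imageI) (simp add: scU_one)
  ultimately have W: "?W = V" using v(2) vV by (auto simp: act_one)
  show ?thesis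
    unfolding l_highest_weight_def
  \<comment> \<open>The series \<gamma>_i collects the eigenvalues \<open>a i r\<close> of the
    \<phi> on \<open>v\<close>.\<close>
  proof (intro conjI module bexI[of _ v] W vV exI[of _ "\<lambda>i. Abs_fps (a i)"] ballI allI)
    show "act (x Plus i (int r)) v = 0" if "i \<in> nodes (dyn T)" for i r
      using kill that v(1) by blast
    show "act (phiU T h Plus i (int r)) v = scale (fps_nth (Abs_fps (a i)) r) v"
      if "i \<in> nodes (dyn T)" for i r
      using a that by simp
  qed
qed

end
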